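(* For $n\geq 1$, let $(\mu_{n},\nu_{n})\in\mathcal{P}(\mathsf{X})\times\mathcal{P}(\mathsf{Y})$, let $\varepsilon_{n}>0$ and let $c_{n}:\mathsf{X}\times\mathsf{Y}\to[0,\infty)$ be measurable. Let $\pi_{n}\in\Pi(\mu_{n},\nu_{n})$ be $(c_{n},\varepsilon_{n})$-cyclically invariant. Suppose that $\mu_{n},\nu_{n}$ converge weakly to some limits $\mu\in\mathcal{P}(\mathsf{X}),\nu\in\mathcal{P}(\mathsf{Y})$, that $\varepsilon_{n}\to\varepsilon>0$, and that $c_{n}$ converges uniformly on bounded sets to a continuous function $c$. Then $\pi_{n}$ converges weakly to a limit $\pi\in\Pi(\mu,\nu)$, and $\pi$ is $(c,\varepsilon)$-cyclically invariant.
   Context: $(\mathsf{X},d)$ and $(\mathsf{Y},d)$ are complete separable metric spaces; $\mathsf{X}\times\mathsf{Y}$ carries the metric $d((x,y),(x',y'))=\max\{d(x,x'),d(y,y')\}$. $\mathcal{P}(\cdot)$ denotes the Borel probability measures with weak convergence (induced by bounded continuous functions); $\Pi(\mu,\nu)$ is the set of couplings, i.e. probability measures on $\mathsf{X}\times\mathsf{Y}$ with first marginal $\mu$ and second marginal $\nu$. $B_r(x)$ is the open ball of radius $r$ around $x$. Standing assumption (differentiation of measures): given $\rho,\lambda\in\mathcal{P}(\mathsf{X})$ with $\rho\ll\lambda$, there exists $\mathsf{X}'\subset\mathsf{X}$ of full $\lambda$-measure such that $f(x):=\lim_{r\to0}\rho(B_r(x))/\lambda(B_r(x))$, $x\in\mathsf{X}'$,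 defines a version of the Radon–Nikodym density $d\rho/d\lambda$. The analogous property is assumed on $\mathsf{X}\times\mathsf{Y}$. Definition: for marginals $\mu,\nu$ with $P:=\mu\otimes\nu$, a cost function $c$ and $\varepsilon>0$, a coupling $\pi\in\Pi(\mu,\nu)$ is $(c,\varepsilon)$-cyclically invariant if $\pi\sim P$ (mutually absolutely continuous) and its density admits a version $d\pi/dP:\mathsf{X}\times\mathsf{Y}\to(0,\infty)$ such that $$\prod_{i=1}^{k} \frac{d\pi}{dP}(x_{i},y_{i})=\exp\bigg(-\frac{1}{\varepsilon}\bigg[\sum_{i=1}^{k} c(x_{i},y_{i}) - \sum_{i=1}^{k} c(x_{i},y_{i+1})\bigg]\bigg)\prod_{i=1}^{k} \frac{d\pi}{dP}(x_{i},y_{i+1})$$ for all $k\in\mathbb{N}$ and $(x_i,y_i)_{i=1}^k\subset\mathsf{X}\times\mathsf{Y}$, where $y_{k+1}:=y_1$. *)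

theory Defs
  imports "HOL-Probability.Probability"
begin

definition borel_probs :: "'a::topological_space measure set" where
  "borel_probs = {M. prob_space M \<and> sets M = sets borel}"

text \<open>The library's \<open>weak_conv_m\<close> concerns distribution functions on the real line only.\<close>

definition weak_conv_to ::
  "(nat \<Rightarrow> 'a::topological_space measure) \<Rightarrow> 'a measure \<Rightarrow> bool" where
  "weak_conv_to M L \<longleftrightarrow>
     (\<forall>f :: 'a \<Rightarrow> real. continuous_on UNIV f \<and> bounded (range f) \<longrightarrow>
        (\<lambda>n. integral\<^sup>L (M n) f) \<longlonglongrightarrow> integral\<^sup>L L f)"

definition couplings ::
  "'a::topological_space measure \<Rightarrow> 'b::topological_space measure \<Rightarrow> ('a \<times> 'b) measure set" where
  "couplings \<mu> \<nu> = {\<pi> \<in> borel_probs. distr \<pi> borel fst = \<mu> \<and> distr \<pi> borel snd = \<nu>}"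

text \<open>
  The type class metric on a product type is the Euclidean combination of the factor metrics. It has
  the same open sets, Borel sets and bounded sets as the maximum metric (see the lemmas below), but
  different balls, and balls enter the differentiation property.
\<close>

definition max_dist :: "'a::metric_space \<times> 'b::metric_space \<Rightarrow> 'a \<times> 'b \<Rightarrow> real" where
  "max_dist p q = max (dist (fst p) (fst q)) (dist (snd p) (snd q))"

definition max_ball :: "'a::metric_space \<times> 'b::metric_space \<Rightarrow> real \<Rightarrow> ('a \<times> 'b) set" where
  "max_ball p r = {q. max_dist p q < r}"

lemma max_dist_le_dist: "max_dist p q \<le> dist p q"
  by (simp add: max_dist_def dist_fst_le dist_snd_le)

lemma dist_le_max_dist: "dist p q \<le> 2 * max_dist p q"
proof -
  have "dist p q \<le> dist (fst p) (fst q) + dist (snd p) (snd q)"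
    by (simp add: dist_prod_def sqrt_sum_squares_le_sum)
  then show ?thesis by (simp add: max_dist_def)
qed

lemma open_iff_max_ball:
  "open S \<longleftrightarrow> (\<forall>p\<in>S. \<exists>r>0. max_ball p r \<subseteq> S)"
proof
  assume S: "open S"
  show "\<forall>p\<in>S. \<exists>r>0. max_ball p r \<subseteq> S"
  proof
    fix p assume "p \<in> S"
    then obtain e where e: "e > 0" "ball p e \<subseteq> S"
      using S open_contains_ball by blast
    have "max_ball p (e / 2) \<subseteq> ball p e"
    proof
      fix q assume "q \<in> max_ball p (e / 2)"
      then show "q \<in> ball p e"
        using dist_le_max_dist[of p q] by (simp add: max_ball_def)
    qed
    then show "\<exists>r>0. max_ball p r \<subseteq> S"
      using e by (intro exI[of _ "e / 2"]) auto
  qed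
next
  assume R: "\<forall>p\<in>S. \<exists>r>0. max_ball p r \<subseteq> S"
  have "ball p r \<subseteq> max_ball p r" for p :: "'a \<times> 'b" and r
  proof
    fix q assume "q \<in> ball p r"
    then show "q \<in> max_ball p r"
      using max_dist_le_dist[of p q] by (simp add: max_ball_def)
  qed
  then show "open S"
    unfolding open_contains_ball using R by (meson subset_trans)
qed

lemma bounded_iff_max_dist:
  "bounded S \<longleftrightarrow> (\<exists>p r. \<forall>q\<in>S. max_dist p q \<le> r)"
proof
  assume "bounded S"
  then obtain p r where "\<forall>q\<in>S. dist p q \<le> r" by (auto simp: bounded_def)
  then show "\<exists>p r. \<forall>q\<in>S. max_dist p q \<le> r"
    using max_dist_le_dist order_trans by blast
next
  assume "\<exists>p r. \<forall>q\<in>S. max_dist p q \<le> r"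
  then obtain p r where pr: "\<forall>q\<in>S. max_dist p q \<le> r" by blast
  have "dist p q \<le> 2 * r" if "q \<in> S" for q
    using pr[rule_format, OF that] dist_le_max_dist[of p q] by linarith
  then show "bounded S" unfolding bounded_def by blast
qed

text \<open>
  The argument \<open>B\<close> gives the ball \<open>B x r\<close> of radius \<open>r\<close> around \<open>x\<close>. Where \<open>B x r\<close> is null for
  \<open>lam\<close>, the quotient is 0 by the convention \<open>x / 0 = 0\<close>; on a separable space this concerns only a
  null set of points \<open>x\<close>, which can be removed from \<open>A\<close>.
\<close>

definition differentiation_property ::
  "('a::topological_space \<Rightarrow> real \<Rightarrow> 'a set) \<Rightarrow> bool" where
  "differentiation_property B \<longleftrightarrow>
     (\<forall>rho\<in>borel_probs. \<forall>lam\<in>borel_probs. absolutely_continuous lam rho \<longrightarrow>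
        (\<exists>A (f :: 'a \<Rightarrow> real). A \<in> sets borel \<and> measure lam A = 1 \<and>
           (\<forall>x\<in>A. ((\<lambda>r. measure rho (B x r) / measure lam (B x r)) \<longlongrightarrow> f x) (at_right 0)) \<and>
           f \<in> borel_measurable borel \<and>
           density lam (\<lambda>x. ennreal (f x)) = rho))"

definition cyclically_invariant ::
  "('a::topological_space \<times> 'b::topological_space \<Rightarrow> real) \<Rightarrow> real \<Rightarrow>
   'a measure \<Rightarrow> 'b measure \<Rightarrow> ('a \<times> 'b) measure \<Rightarrow> bool" where
  "cyclically_invariant c \<epsilon> \<mu> \<nu> \<pi> \<longleftrightarrow>
     \<pi> \<in> couplings \<mu> \<nu> \<and>
     absolutely_continuous (\<mu> \<Otimes>\<^sub>M \<nu>) \<pi> \<and> absolutely_continuous \<pi> (\<mu> \<Otimes>\<^sub>M \<nu>) \<and>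
     (\<exists>Z :: 'a \<times> 'b \<Rightarrow> real.
        Z \<in> borel_measurable (\<mu> \<Otimes>\<^sub>M \<nu>) \<and> (\<forall>p. Z p > 0) \<and>
        density (\<mu> \<Otimes>\<^sub>M \<nu>) (\<lambda>p. ennreal (Z p)) = \<pi> \<and>
        (\<forall>k\<ge>1. \<forall>(x :: nat \<Rightarrow> 'a) (y :: nat \<Rightarrow> 'b). y (k + 1) = y 1 \<longrightarrow>
           (\<Prod>i=1..k. Z (x i, y i)) =
             exp (- (1 / \<epsilon>) * ((\<Sum>i=1..k. c (x i, y i)) - (\<Sum>i=1..k. c (x i, y (i + 1))))) *
             (\<Prod>i=1..k. Z (x i, y (i + 1)))))"

end

theory Submission
  imports Defs
begin

text \<open>
  The proof combines compactness of the couplings, a reformulation of cyclical invariance that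
  survives weak limits, and uniqueness of the cyclically invariant coupling.

  Let \<open>swap\<close> exchange the second coordinates of two points of the product space, let \<open>excess c\<close> be
  the change of cost \<open>c(x\<^sub>1,y\<^sub>1) + c(x\<^sub>2,y\<^sub>2) - c(x\<^sub>1,y\<^sub>2) - c(x\<^sub>2,y\<^sub>1)\<close>, and let \<open>\<pi>\<close> be a
  coupling. The cyclical identity for two points says that the measure with density
  \<open>exp (excess c / (2 \<epsilon>))\<close> with respect to \<open>\<pi> \<otimes> \<pi>\<close> is invariant under \<open>swap\<close>. This statement,
  \<open>swap_invariant\<close>, mentions neither \<open>\<mu> \<otimes> \<nu>\<close> nor the density of \<open>\<pi>\<close>. It passes to weak limits: it
  suffices to integrate continuous functions that vanish where \<open>\<bar>excess c\<bar>\<close> or the distance to a fixed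
  point is large, and there the exponentials converge uniformly (\<open>swap_invariant_limit\<close>).

  Conversely, let \<open>\<pi>\<close> be swap invariant. The pair \<open>(x\<^sub>1, y\<^sub>2)\<close> has law \<open>\<mu> \<otimes> \<nu>\<close> under \<open>\<pi> \<otimes> \<pi>\<close>, while
  \<open>(x\<^sub>1, y\<^sub>1)\<close> has law \<open>\<pi>\<close>, and \<open>swap\<close> carries one pair to the other; as \<open>swap\<close> preserves the null
  sets of \<open>\<pi> \<otimes> \<pi>\<close>, \<open>\<pi>\<close> and \<open>\<mu> \<otimes> \<nu>\<close> are equivalent. The density then satisfies the identity for two
  points almost everywhere; by Fubini one of the two points can be frozen, which writes the density
  almost everywhere as \<open>a(x) b(y) exp (- c(x,y) / \<epsilon>)\<close> with \<open>a, b > 0\<close>. This product is a version that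
  satisfies every cyclical identity everywhere (\<open>swap_invariant_imp_cyclically_invariant\<close>).

  Two cyclically invariant couplings with the same marginals have a density quotient \<open>a(x) b(y)\<close>. With
  the bounded function \<open>u(t) = (t - 1) / (t + 1)\<close>, the integrals of \<open>u(a(x)) + u(b(y))\<close> under both
  couplings agree because they depend on the marginals only; their difference is the integral of a
  nonnegative function that vanishes only where \<open>a(x) b(y) = 1\<close>. So the couplings coincide
  (\<open>cyclically_invariant_unique\<close>). The function \<open>u\<close> replaces the logarithm, which need not be
  integrable.

  Compactness (\<open>couplings_subsequence_limit\<close>) is obtained by coding. Countably many events are recorded
  in the ternary digits of a real number, Helly's selection theorem gives a limit law of the codes,
  and a limit coupling is read off from it. The events are membership in balls whose spheres are null
  for the limit marginals, so that the digits belonging to one factor have, under the limit law, the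
  same law as for a random point with distribution \<open>\<mu>\<close> or \<open>\<nu>\<close>; therefore they almost surely
  describe a point. Finite intersections of the chosen rectangles form an open base on which the
  probabilities converge, and this implies weak convergence of the couplings and of their squares.
\<close>

section \<open>Weak convergence from a base of the topology\<close>

lemma borel_probsD:
  assumes "M \<in> borel_probs"
  shows "prob_space M" "sets M = sets borel" "space M = UNIV"
  using assms sets_eq_imp_space_eq[of M borel] by (auto simp: borel_probs_def)

text \<open>
  A base that is closed under finite intersections determines the probabilities of all finite unions of
  its members, hence controls all open sets from below. In contrast to weak convergence, this property
  passes to product measures at once.
\<close>

definition converge_on_base ::
  "(nat \<Rightarrow> 'a::topological_space measure) \<Rightarrow> 'a measure \<Rightarrow> 'a set set \<Rightarrow> bool" where
  "converge_on_base M L R \<longleftrightarrow> countable R \<and> R \<subseteq> sets borel \<and>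
     (\<forall>A\<in>R. \<forall>B\<in>R. A \<inter> B \<in> R) \<and> UNIV \<in> R \<and>
     (\<forall>U. open U \<longrightarrow> (\<exists>S\<subseteq>R. U = \<Union>S)) \<and>
     (\<forall>A\<in>R. (\<lambda>n. measure (M n) A) \<longlonglongrightarrow> measure L A)"

text \<open>
  Inclusion and exclusion, one set at a time. Intersecting the union with an arbitrary further member of
  the base makes the induction hypothesis applicable to the overlap with the new set.
\<close>

lemma converge_on_finite_Union:
  assumes R: "converge_on_base M L R"
    and M: "\<And>n. M n \<in> borel_probs" and L: "L \<in> borel_probs"
    and F: "finite F" "F \<subseteq> R"
  shows "(\<lambda>n. measure (M n) (\<Union>F)) \<longlonglongrightarrow> measure L (\<Union>F)"
proof -
  have sets: "A \<in> sets N" if "A \<in> R" "N \<in> borel_probs" for A and N :: "'a measure"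
    using R borel_probsD(2)[OF that(2)] that(1) by (auto simp: converge_on_base_def)
  have un: "measure N (B \<inter> \<Union>(insert A G)) =
      measure N (B \<inter> \<Union>G) + measure N (B \<inter> A) - measure N ((B \<inter> A) \<inter> \<Union>G)"
    if "A \<in> R" "B \<in> R" "finite G" "G \<subseteq> R" "N \<in> borel_probs" for A B G and N :: "'a measure"
  proof -
    interpret prob_space N using borel_probsD that by blast
    have [measurable]: "A \<in> sets N" "B \<in> sets N" "\<Union>G \<in> sets N"
      using that sets by (auto intro!: sets.finite_Union)
    have "B \<inter> \<Union>(insert A G) = (B \<inter> \<Union>G) \<union> (B \<inter> A)" by auto
    then have "measure N (B \<inter> \<Union>(insert A G)) =
        measure N (B \<inter> \<Union>G) + measure N ((B \<inter> A) - (B \<inter> \<Union>G))"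
      by (simp add: finite_measure_Union')
    also have "measure N ((B \<inter> A) - (B \<inter> \<Union>G)) = measure N (B \<inter> A) - measure N ((B \<inter> A) \<inter> \<Union>G)"
      by (subst finite_measure_Diff') (auto intro!: arg_cong[where f = "measure N"])
    finally show ?thesis by simp
  qed
  have "\<forall>B\<in>R. (\<lambda>n. measure (M n) (B \<inter> \<Union>F)) \<longlonglongrightarrow> measure L (B \<inter> \<Union>F)"
    using F
  proof (induction F)
    case (insert A G)
    show ?case
    proof
      fix B assume B: "B \<in> R"
      have AB: "B \<inter> A \<in> R" using R B insert.prems by (auto simp: converge_on_base_def)
      have "(\<lambda>n. measure (M n) (B \<inter> \<Union>G) + measure (M n) (B \<inter> A) - measure (M n) ((B \<inter> A) \<inter> \<Union>G))
          \<longlonglongrightarrow> measure L (B \<inter> \<Union>G) + measure L (B \<inter> A) - measure L ((B \<inter> A) \<inter> \<Union>G)"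
        using insert B AB R by (intro tendsto_intros) (auto simp: converge_on_base_def)
      then show "(\<lambda>n. measure (M n) (B \<inter> \<Union>(insert A G))) \<longlonglongrightarrow> measure L (B \<inter> \<Union>(insert A G))"
        using insert.prems insert.hyps B M L un by simp
    qed
  qed simp
  moreover have "UNIV \<in> R" using R by (simp add: converge_on_base_def)
  ultimately show ?thesis by fastforce
qed

lemma converge_on_base_imp_open_lower:
  assumes R: "converge_on_base M L R"
    and M: "\<And>n. M n \<in> borel_probs" and L: "L \<in> borel_probs"
    and U: "open U" and e: "e > 0"
  shows "\<forall>\<^sub>F n in sequentially. measure (M n) U > measure L U - e"
proof (cases "U = {}")
  case False
  interpret L: prob_space L using L borel_probsD by blast
  obtain S where S: "S \<subseteq> R" "U = \<Union>S" using R U by (auto simp: converge_on_base_def)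
  have "countable S" "S \<noteq> {}" using S R False countable_subset by (auto simp: converge_on_base_def)
  then obtain f :: "nat \<Rightarrow> _" where f: "range f = S" using uncountable_def by blast
  have fR: "range f \<subseteq> R" using f S by simp
  then have fb: "f i \<in> sets borel" for i using R by (auto simp: converge_on_base_def)
  have "(\<lambda>m. measure L (\<Union>(f ` {..<m}))) \<longlonglongrightarrow> measure L (\<Union>m. \<Union>(f ` {..<m}))"
  proof (rule L.finite_Lim_measure_incseq)
    show "incseq (\<lambda>m. \<Union>(f ` {..<m}))"
      unfolding incseq_def by (intro allI impI Union_mono image_mono) simp
  qed (use fb borel_probsD[OF L] in \<open>auto intro!: sets.finite_UN\<close>)
  also have "(\<Union>m. \<Union>(f ` {..<m})) = U" using S f by (auto intro: lessI)
  finally obtain m where m: "measure L (\<Union>(f ` {..<m})) > measure L U - e"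
    using e order_tendstoD(1)[of _ "measure L U" sequentially "measure L U - e"]
    by (metis (no_types, lifting) diff_less_eq eventually_happens less_add_same_cancel1 trivial_limit_sequentially)
  have "(\<lambda>n. measure (M n) (\<Union>(f ` {..<m}))) \<longlonglongrightarrow> measure L (\<Union>(f ` {..<m}))"
    using fR by (intro converge_on_finite_Union[OF R M L]) auto
  from order_tendstoD(1)[OF this m]
  have "\<forall>\<^sub>F n in sequentially. measure (M n) (\<Union>(f ` {..<m})) > measure L U - e" .
  then show ?thesis
  proof eventually_elim
    case (elim n)
    have "measure (M n) (\<Union>(f ` {..<m})) \<le> measure (M n) U"
      using S f fb U borel_probsD[OF M[of n]]
      by (intro finite_measure.finite_measure_mono) (auto simp: prob_space.finite_measure)
    then show ?case using elim by simp
  qed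
qed (use e in simp)

text \<open>
  A function with values in \<open>[0,1)\<close> is approximated from below, up to \<open>1/m\<close>, by the average of the
  indicators of the open sets where it exceeds \<open>j/m\<close>; so the lower bounds for open sets carry over to
  its integral.
\<close>

lemma open_lower_imp_integral_lower:
  fixes f :: "'a::topological_space \<Rightarrow> real"
  assumes M: "\<And>n. M n \<in> borel_probs" and L: "L \<in> borel_probs"
    and open_lower: "\<And>U e. open U \<Longrightarrow> e > 0 \<Longrightarrow> \<forall>\<^sub>F n in sequentially. measure (M n) U > measure L U - e"
    and f: "continuous_on UNIV f" "\<And>x. 0 \<le> f x" "\<And>x. f x < 1" and e: "e > 0"
  shows "\<forall>\<^sub>F n in sequentially. integral\<^sup>L (M n) f > integral\<^sup>L L f - e"
proof -
  obtain m where m: "m > 0" "1 / real m < e / 2"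
    using e nat_approx_posE[of "e / 2"] by (metis half_gt_zero zero_less_Suc)
  define U where "U j = {x. f x > real j / real m}" for j :: nat
  have oU: "open (U j)" for j
    unfolding U_def by (intro open_Collect_less continuous_on_const f)
  define g where "g x = (\<Sum>j\<in>{1..m}. indicator (U j) x) / real m" for x
  have fm: "f \<in> borel_measurable borel" by (rule borel_measurable_continuous_onI[OF f(1)])
  have g: "f x - 1 / m \<le> g x \<and> g x \<le> f x" for x
  proof -
    \<comment> \<open>the number of \<open>j \<ge> 1\<close> with \<open>j / m < f x\<close>\<close>
    let ?k = "nat \<lceil>f x * m\<rceil> - 1"
    have k: "j < f x * m \<longleftrightarrow> j \<le> ?k" if "j \<ge> 1" for j :: nat
      using that f(2)[of x] by linarith
    have km: "?k \<le> m"
    proof -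
      have "f x * m \<le> m" using f(3)[of x] m by simp
      then show ?thesis by linarith
    qed
    have "(\<Sum>j\<in>{1..m}. indicator (U j) x) = (\<Sum>j\<in>{1..m}. if j \<le> ?k then 1 else (0::real))"
      using m k by (intro sum.cong) (auto simp: U_def field_simps indicator_def)
    also have "\<dots> = real (card ({1..m} \<inter> {j. j \<le> ?k}))"
      by (simp add: sum.If_cases)
    also have "{1..m} \<inter> {j. j \<le> ?k} = {1..?k}" using km by auto
    finally have s: "(\<Sum>j\<in>{1..m}. indicator (U j) x) = real ?k" by simp
    have "f x * m - 1 \<le> real ?k" by linarith
    moreover have "real (nat \<lceil>a\<rceil> - 1) \<le> a" if "a \<ge> 0" for a :: real
      using that by linarith
    then have "real ?k \<le> f x * m"
      using f(2)[of x] by simp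
    ultimately show ?thesis
      using m unfolding g_def s by (simp add: divide_simps mult.commute)
  qed
  have int: "integral\<^sup>L N g = (\<Sum>j\<in>{1..m}. measure N (U j)) / m"
     and fg: "integral\<^sup>L N f - 1 / m \<le> integral\<^sup>L N g" "integral\<^sup>L N g \<le> integral\<^sup>L N f"
    if N: "N \<in> borel_probs" for N
  proof -
    interpret prob_space N using N borel_probsD by blast
    have [measurable_cong]: "sets N = sets borel" using borel_probsD[OF N] by simp
    have [measurable]: "U j \<in> sets borel" for j using oU by simp
    have [measurable]: "f \<in> borel_measurable borel" by fact
    have [measurable]: "g \<in> borel_measurable borel" unfolding g_def by measurable
    have "f x \<le> 1" for x using f(3)[of x] by simp
    then have fi: "integrable N f"
      using f(2) by (intro integrable_const_bound[of _ 1]) auto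
    have ui: "integrable N (indicator (U j) :: _ \<Rightarrow> real)" for j
      by (intro integrable_const_bound[of _ 1]) auto
    have gi: "integrable N g" unfolding g_def using ui by simp
    show "integral\<^sup>L N g = (\<Sum>j\<in>{1..m}. measure N (U j)) / m"
      unfolding g_def using ui borel_probsD[OF N] by simp
    have "integral\<^sup>L N f - 1 / m = (\<integral>x. f x - 1 / m \<partial>N)"
      using fi by (simp add: prob_space)
    also have "\<dots> \<le> integral\<^sup>L N g"
      using g fi gi by (intro integral_mono) auto
    finally show "integral\<^sup>L N f - 1 / m \<le> integral\<^sup>L N g" .
    show "integral\<^sup>L N g \<le> integral\<^sup>L N f" using g fi gi by (intro integral_mono) auto
  qed
  have "\<forall>\<^sub>F n in sequentially. \<forall>j\<in>{1..m}. measure (M n) (U j) > measure L (U j) - e / 2"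
    using open_lower[OF oU] e by (intro eventually_ball_finite) auto
  then show ?thesis
  proof eventually_elim
    case (elim n)
    have "(\<Sum>j\<in>{1..m}. measure L (U j)) - m * (e / 2) = (\<Sum>j\<in>{1..m}. measure L (U j) - e / 2)"
      by (simp add: sum_subtractf)
    also have "\<dots> \<le> (\<Sum>j\<in>{1..m}. measure (M n) (U j))"
      using elim by (intro sum_mono) (auto intro: less_imp_le)
    finally have "(\<Sum>j\<in>{1..m}. measure L (U j)) / m - e / 2 \<le> (\<Sum>j\<in>{1..m}. measure (M n) (U j)) / m"
      using m by (simp add: divide_simps mult.commute)
    then have "integral\<^sup>L L g - e / 2 \<le> integral\<^sup>L (M n) g"
      using int L M by simp
    then show ?case using fg[OF L] fg[OF M[of n]] m by linarith
  qed
qed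

text \<open>
  For a continuous \<open>f\<close> with \<open>\<bar>f\<bar> < b\<close>, the lower bound for integrals applies to \<open>(f + b) / (2 b)\<close> and to
  \<open>(- f + b) / (2 b)\<close>; together these are two-sided.
\<close>

lemma open_lower_imp_weak_conv_to:
  assumes M: "\<And>n. M n \<in> borel_probs" and L: "L \<in> borel_probs"
    and open_lower: "\<And>U e. open U \<Longrightarrow> e > 0 \<Longrightarrow> \<forall>\<^sub>F n in sequentially. measure (M n) U > measure L U - e"
  shows "weak_conv_to M L"
  unfolding weak_conv_to_def
proof (intro allI impI, elim conjE)
  fix f :: "'a \<Rightarrow> real" assume f: "continuous_on UNIV f" and "bounded (range f)"
  then obtain b where b: "b > 0" "\<And>x. \<bar>f x\<bar> < b"
    unfolding bounded_pos_less by auto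
  define u where "u s x = (s * f x + b) / (2 * b)" for s x
  have u: "continuous_on UNIV (u s)" "0 \<le> u s x" "u s x < 1" if "s = 1 \<or> s = -1" for s x
    using that f b(1) b(2)[of x] unfolding u_def by (auto intro!: continuous_intros simp: field_simps)
  have ui: "integral\<^sup>L N (u s) = (s * integral\<^sup>L N f + b) / (2 * b)" if N: "N \<in> borel_probs" for N s
  proof -
    interpret prob_space N using N borel_probsD by blast
    have [measurable_cong]: "sets N = sets borel" using borel_probsD[OF N] by simp
    have [measurable]: "f \<in> borel_measurable borel" by (rule borel_measurable_continuous_onI[OF f])
    have "integrable N f"
      using b less_imp_le by (intro integrable_const_bound[of _ b]) auto
    then show ?thesis unfolding u_def by (simp add: prob_space)
  qed
  show "(\<lambda>n. integral\<^sup>L (M n) f) \<longlonglongrightarrow> integral\<^sup>L L f"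
  proof (rule tendstoI)
    fix e :: real assume "e > 0"
    then have e': "e / (2 * b) > 0" using b by simp
    have "\<forall>\<^sub>F n in sequentially. integral\<^sup>L (M n) (u s) > integral\<^sup>L L (u s) - e / (2 * b)"
      if "s = 1 \<or> s = -1" for s
      by (rule open_lower_imp_integral_lower[OF M L open_lower u[OF that] e'])
    then have "\<forall>\<^sub>F n in sequentially. integral\<^sup>L (M n) (u 1) > integral\<^sup>L L (u 1) - e / (2 * b)"
       "\<forall>\<^sub>F n in sequentially. integral\<^sup>L (M n) (u (-1)) > integral\<^sup>L L (u (-1)) - e / (2 * b)"
      by auto
    then show "\<forall>\<^sub>F n in sequentially. dist (integral\<^sup>L (M n) f) (integral\<^sup>L L f) < e"
    proof eventually_elim
      case (elim n)
      then have "integral\<^sup>L (M n) f > integral\<^sup>L L f - e" "integral\<^sup>L (M n) f < integral\<^sup>L L f + e"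
        using b by (simp_all add: ui M L divide_less_cancel flip: diff_divide_distrib)
      then show ?case
        by (simp add: dist_real_def)
    qed
  qed
qed

lemma converge_on_base_imp_weak_conv_to:
  assumes "converge_on_base M L R" "\<And>n. M n \<in> borel_probs" "L \<in> borel_probs"
  shows "weak_conv_to M L"
  using assms by (intro open_lower_imp_weak_conv_to converge_on_base_imp_open_lower)

lemma open_indicator_continuous_approx:
  fixes U :: "'a::metric_space set"
  assumes U: "open U"
  obtains g :: "nat \<Rightarrow> 'a \<Rightarrow> real" where "\<And>k. continuous_on UNIV (g k)" "\<And>k x. 0 \<le> g k x"
    "\<And>k x. g k x \<le> indicator U x" "\<And>x. (\<lambda>k. g k x) \<longlonglongrightarrow> indicator U x"
proof (cases "U = UNIV")
  case True
  then show ?thesis by (intro that[of "\<lambda>_ _. 1"]) auto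
next
  case False
  define g where "g k x = min 1 (real k * infdist x (- U))" for k x
  show ?thesis
  proof (rule that[of g])
    show "continuous_on UNIV (g k)" for k
      unfolding g_def by (intro continuous_intros)
    show "0 \<le> g k x" "g k x \<le> indicator U x" for k x
      using infdist_nonneg[of x "- U"] by (auto simp: g_def indicator_def)
    show "(\<lambda>k. g k x) \<longlonglongrightarrow> indicator U x" for x
    proof (cases "x \<in> U")
      case True
      then have pos: "infdist x (- U) > 0"
        using U False in_closed_iff_infdist_zero[of "- U" x] infdist_nonneg[of x "- U"]
        by (auto simp: less_le)
      have "\<forall>\<^sub>F k in sequentially. real k > 1 / infdist x (- U)"
        using filterlim_real_sequentially by (simp add: filterlim_at_top_dense)
      then have "\<forall>\<^sub>F k in sequentially. g k x = indicator U x"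
        by eventually_elim (use pos True in \<open>auto simp: g_def field_simps\<close>)
      then show ?thesis by (rule tendsto_eventually)
    qed (simp add: g_def)
  qed
qed

lemma integral_continuous_approx_open:
  fixes g :: "nat \<Rightarrow> 'a::topological_space \<Rightarrow> real"
  assumes L: "finite_measure L" "sets L = sets borel" and U: "open U"
    and g: "\<And>k. continuous_on UNIV (g k)" "\<And>k x. 0 \<le> g k x" "\<And>k x. g k x \<le> indicator U x"
      "\<And>x. (\<lambda>k. g k x) \<longlonglongrightarrow> indicator U x"
  shows "(\<lambda>k. integral\<^sup>L L (g k)) \<longlonglongrightarrow> measure L U" "integral\<^sup>L L (g k) \<le> measure L U"
proof -
  interpret finite_measure L by fact
  have [measurable_cong]: "sets L = sets borel" by fact
  have [measurable]: "g k \<in> borel_measurable borel" for k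
    by (rule borel_measurable_continuous_onI[OF g(1)])
  have [measurable]: "U \<in> sets borel" using U by simp
  have g1: "norm (g k x) \<le> 1" for k x
    using g(2)[of k x] g(3)[of k x] by (cases "x \<in> U") auto
  have m: "(\<integral>x. indicator U x \<partial>L) = measure L U"
    using sets_eq_imp_space_eq[OF L(2)] by simp
  have "(\<lambda>k. integral\<^sup>L L (g k)) \<longlonglongrightarrow> (\<integral>x. indicator U x \<partial>L)"
    using g(4) g1 by (intro integral_dominated_convergence[where w = "\<lambda>_. 1"]) auto
  then show "(\<lambda>k. integral\<^sup>L L (g k)) \<longlonglongrightarrow> measure L U"
    unfolding m .
  have "integral\<^sup>L L (g k) \<le> (\<integral>x. indicator U x \<partial>L)"
    using g(2,3) g1 by (intro integral_mono integrable_const_bound[of _ 1]) auto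
  then show "integral\<^sup>L L (g k) \<le> measure L U" unfolding m .
qed

lemma weak_conv_to_open_lower:
  fixes L :: "'a::metric_space measure"
  assumes wc: "weak_conv_to M L"
    and M: "\<And>n. M n \<in> borel_probs" and L: "L \<in> borel_probs"
    and U: "open U" and e: "e > 0"
  shows "\<forall>\<^sub>F n in sequentially. measure (M n) U > measure L U - e"
proof -
  obtain g :: "nat \<Rightarrow> 'a \<Rightarrow> real" where g: "\<And>k. continuous_on UNIV (g k)" "\<And>k x. 0 \<le> g k x"
    "\<And>k x. g k x \<le> indicator U x" "\<And>x. (\<lambda>k. g k x) \<longlonglongrightarrow> indicator U x"
    using open_indicator_continuous_approx[OF U] by blast
  have fin: "finite_measure N" "sets N = sets borel" if "N \<in> borel_probs" for N :: "'a measure"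
    using borel_probsD[OF that] by (auto simp: prob_space.finite_measure)
  note approx = integral_continuous_approx_open[OF fin U g]
  have g1: "norm (g k x) \<le> 1" for k x
    using g(2)[of k x] g(3)[of k x] by (cases "x \<in> U") auto
  from order_tendstoD(1)[OF approx(1)[OF L L], of "measure L U - e"] e
  obtain k where k: "integral\<^sup>L L (g k) > measure L U - e"
    using eventually_happens by fastforce
  have "(\<lambda>n. integral\<^sup>L (M n) (g k)) \<longlonglongrightarrow> integral\<^sup>L L (g k)"
    using wc g(1)[of k] g1[of k] unfolding weak_conv_to_def bounded_iff by blast
  from order_tendstoD(1)[OF this k] show ?thesis
    by eventually_elim (use approx(2)[OF M M] in \<open>auto intro: less_le_trans\<close>)
qed

lemma finite_measure_eqI_continuous:
  fixes M N :: "'a::metric_space measure"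
  assumes M: "finite_measure M" "sets M = sets borel" and N: "finite_measure N" "sets N = sets borel"
    and eq: "\<And>f :: 'a \<Rightarrow> real. continuous_on UNIV f \<Longrightarrow> (\<And>x. 0 \<le> f x) \<Longrightarrow> (\<And>x. f x \<le> 1) \<Longrightarrow>
      integral\<^sup>L M f = integral\<^sup>L N f"
  shows "M = N"
proof (rule measure_eqI_generator_eq[where E = "{S. open S}" and \<Omega> = UNIV and A = "\<lambda>_. UNIV"])
  show "emeasure M X = emeasure N X" if "X \<in> {S. open S}" for X
  proof -
    have U: "open X" using that by simp
    obtain g :: "nat \<Rightarrow> 'a \<Rightarrow> real" where g: "\<And>k. continuous_on UNIV (g k)" "\<And>k x. 0 \<le> g k x"
      "\<And>k x. g k x \<le> indicator X x" "\<And>x. (\<lambda>k. g k x) \<longlonglongrightarrow> indicator X x"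
      using open_indicator_continuous_approx[OF U] by blast
    have "g k x \<le> 1" for k x
      using g(3)[of k x] by (cases "x \<in> X") auto
    then have "integral\<^sup>L M (g k) = integral\<^sup>L N (g k)" for k
      using g by (intro eq) auto
    then have "measure M X = measure N X"
      using integral_continuous_approx_open(1)[OF M U g] integral_continuous_approx_open(1)[OF N U g]
      by (simp add: LIMSEQ_unique)
    then show ?thesis
      using M N by (simp add: finite_measure.emeasure_eq_measure)
  qed
  show "emeasure M UNIV \<noteq> \<infinity>"
    using M(1) by (simp add: finite_measure.emeasure_eq_measure)
qed (auto simp: Int_stable_def M N borel_def)

text \<open>
  The open set is bounded from below, the complement of the closed set as well; equality of the limit
  measures of the two sets squeezes the probabilities in between.
\<close>

lemma weak_conv_to_continuity_set:
  fixes L :: "'a::metric_space measure"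
  assumes wc: "weak_conv_to M L"
    and M: "\<And>n. M n \<in> borel_probs" and L: "L \<in> borel_probs"
    and "open U" "closed F" "U \<subseteq> F" "measure L F = measure L U"
  shows "(\<lambda>n. measure (M n) U) \<longlonglongrightarrow> measure L U"
proof (rule tendstoI)
  fix e :: real assume e: "e > 0"
  have 1: "\<forall>\<^sub>F n in sequentially. measure (M n) U > measure L U - e"
    by (rule weak_conv_to_open_lower[OF wc M L \<open>open U\<close> e])
  have 2: "\<forall>\<^sub>F n in sequentially. measure (M n) (- F) > measure L (- F) - e"
    using \<open>closed F\<close> by (intro weak_conv_to_open_lower[OF wc M L _ e]) auto
  have compl: "measure N (- F) = 1 - measure N F" if N: "N \<in> borel_probs" for N :: "'a measure"
    using prob_space.prob_compl[of N F] borel_probsD[OF N] \<open>closed F\<close> by (simp add: Compl_eq_Diff_UNIV)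
  show "\<forall>\<^sub>F n in sequentially. dist (measure (M n) U) (measure L U) < e"
    using 1 2
  proof eventually_elim
    case (elim n)
    have "measure (M n) U \<le> measure (M n) F"
      using assms borel_probsD[OF M[of n]]
      by (intro finite_measure.finite_measure_mono) (auto simp: prob_space.finite_measure)
    then show ?case
      using elim compl[OF L] compl[OF M[of n]] assms(7) by (simp add: dist_real_def)
  qed
qed

lemma sets_pair_borel:
  fixes M :: "'a::second_countable_topology measure" and N :: "'b::second_countable_topology measure"
  assumes "sets M = sets borel" "sets N = sets borel"
  shows "sets (M \<Otimes>\<^sub>M N) = sets borel"
  using sets_pair_measure_cong[OF assms] unfolding borel_prod .

lemma pair_borel_probs:
  fixes M :: "'a::second_countable_topology measure" and N :: "'b::second_countable_topology measure"
  assumes "M \<in> borel_probs" "N \<in> borel_probs"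
  shows "M \<Otimes>\<^sub>M N \<in> borel_probs"
  using prob_space_pair[of M N] borel_probsD[OF assms(1)] borel_probsD[OF assms(2)]
  by (simp add: borel_probs_def sets_pair_borel)

lemma converge_on_base_pair:
  fixes L :: "'a::second_countable_topology measure"
  assumes R: "converge_on_base M L R" and M: "\<And>n. M n \<in> borel_probs" and L: "L \<in> borel_probs"
  shows "converge_on_base (\<lambda>n. M n \<Otimes>\<^sub>M M n) (L \<Otimes>\<^sub>M L) ((\<lambda>(A, B). A \<times> B) ` (R \<times> R))"
  unfolding converge_on_base_def
proof (intro conjI ballI allI impI)
  let ?R = "(\<lambda>(A, B). A \<times> B) ` (R \<times> R)"
  have Rb: "A \<in> sets borel" if "A \<in> R" for A using R that by (auto simp: converge_on_base_def)
  show "countable ?R" using R by (auto simp: converge_on_base_def)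
  show "?R \<subseteq> sets borel"
    unfolding borel_prod[symmetric] using Rb by (auto intro: pair_measureI)
  show "UNIV \<in> ?R" using R by (auto simp: converge_on_base_def intro!: image_eqI[of _ _ "(UNIV, UNIV)"])
  show "S \<inter> T \<in> ?R" if ST: "S \<in> ?R" "T \<in> ?R" for S T
  proof -
    obtain A B A' B' where AB: "A \<in> R" "B \<in> R" "A' \<in> R" "B' \<in> R" "S = A \<times> B" "T = A' \<times> B'"
      using ST by auto
    then have "S \<inter> T = (A \<inter> A') \<times> (B \<inter> B')" "A \<inter> A' \<in> R" "B \<inter> B' \<in> R"
      using R by (auto simp: converge_on_base_def)
    then show ?thesis by blast
  qed
  have prod: "measure (N \<Otimes>\<^sub>M N) (A \<times> B) = measure N A * measure N B"
    if "A \<in> R" "B \<in> R" "N \<in> borel_probs" for A B N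
  proof -
    interpret N: prob_space N using borel_probsD that by blast
    have "emeasure (N \<Otimes>\<^sub>M N) (A \<times> B) = emeasure N A * emeasure N B"
      using that Rb borel_probsD[OF that(3)] by (intro N.emeasure_pair_measure_Times) auto
    then show ?thesis
      by (simp add: measure_def enn2real_mult)
  qed
  show "(\<lambda>n. measure (M n \<Otimes>\<^sub>M M n) S) \<longlonglongrightarrow> measure (L \<Otimes>\<^sub>M L) S" if "S \<in> ?R" for S
    using that R M L by (auto simp: prod converge_on_base_def intro!: tendsto_mult)
  fix U :: "('a \<times> 'a) set" assume U: "open U"
  have "U \<subseteq> \<Union>{S \<in> ?R. S \<subseteq> U}"
  proof
    fix p assume "p \<in> U"
    then obtain a b where ab: "open a" "open b" "p \<in> a \<times> b" "a \<times> b \<subseteq> U"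
      using open_prod_elim[OF U] by metis
    obtain S T where "S \<subseteq> R" "a = \<Union>S" "T \<subseteq> R" "b = \<Union>T"
      using R ab unfolding converge_on_base_def by metis
    then obtain A B where AB: "A \<in> R" "B \<in> R" "fst p \<in> A" "snd p \<in> B" "A \<subseteq> a" "B \<subseteq> b"
      using ab(3) by (auto simp: mem_Times_iff)
    then have "A \<times> B \<in> ?R" "p \<in> A \<times> B" "A \<times> B \<subseteq> U" using ab by (auto simp: mem_Times_iff)
    then show "p \<in> \<Union>{S \<in> ?R. S \<subseteq> U}" by blast
  qed
  then show "\<exists>S\<subseteq>?R. U = \<Union>S" by (intro exI[of _ "{S \<in> ?R. S \<subseteq> U}"]) auto
qed

section \<open>Codes for sequences of events\<close>

text \<open>
  Writing bits as ternary digits leaves a gap: the code lies in \<open>[0, 1/6]\<close> or in \<open>[1/3, 1/2]\<close>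
  according to its first bit, so a continuous function on the real line can read that bit.
\<close>

definition ternary_code :: "(nat \<Rightarrow> bool) \<Rightarrow> real" where
  "ternary_code b = (\<Sum>k. of_bool (b k) * (1 / 3) ^ Suc k)"

text \<open>
  On codes, \<open>digit\<close> reads the first bit and \<open>shift\<close> below drops it; both are continuous on the whole
  line.
\<close>

definition digit :: "real \<Rightarrow> real" where
  "digit t = max 0 (min 1 (6 * t - 1))"

definition shift :: "real \<Rightarrow> real" where
  "shift t = 3 * t - digit t"

lemma summable_ternary_code: "summable (\<lambda>k. of_bool (b k) * (1 / 3 :: real) ^ Suc k)"
  by (rule summable_comparison_test'[of "\<lambda>k. (1 / 3 :: real) ^ k" 0])
     (auto intro: summable_geometric)

lemma ternary_code_nonneg: "0 \<le> ternary_code b"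
  unfolding ternary_code_def by (intro suminf_nonneg summable_ternary_code) auto

lemma ternary_code_le: "ternary_code b \<le> 1 / 2"
proof -
  have s: "(\<lambda>k. (1 / 3 :: real) ^ Suc k) sums (1 / 2)"
    using sums_mult[OF geometric_sums[of "1 / 3 :: real"], of "1 / 3"] by simp
  have "ternary_code b \<le> (\<Sum>k. (1 / 3 :: real) ^ Suc k)"
    unfolding ternary_code_def
    by (intro suminf_le summable_ternary_code sums_summable[OF s]) auto
  then show ?thesis using sums_unique[OF s] by simp
qed

lemma ternary_code_head: "ternary_code b = of_bool (b 0) / 3 + ternary_code (\<lambda>k. b (Suc k)) / 3"
proof -
  have "ternary_code b = of_bool (b 0) / 3 + (\<Sum>k. of_bool (b (Suc k)) * (1 / 3) ^ Suc (Suc k))"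
    unfolding ternary_code_def using suminf_split_head[OF summable_ternary_code[of b]] by simp
  also have "(\<Sum>k. of_bool (b (Suc k)) * (1 / 3 :: real) ^ Suc (Suc k)) = ternary_code (\<lambda>k. b (Suc k)) / 3"
    unfolding ternary_code_def using suminf_mult[OF summable_ternary_code[of "\<lambda>k. b (Suc k)"], of "1 / 3"]
    by (simp add: algebra_simps)
  finally show ?thesis .
qed

lemma digit_ternary_code: "digit (ternary_code b) = of_bool (b 0)"
  using ternary_code_head[of b] ternary_code_nonneg[of "\<lambda>k. b (Suc k)"] ternary_code_le[of "\<lambda>k. b (Suc k)"]
  by (auto simp: digit_def min_def max_def)

lemma digit_shift_ternary_code: "digit ((shift ^^ k) (ternary_code b)) = of_bool (b k)"
proof -
  have tail: "shift (ternary_code a) = ternary_code (\<lambda>i. a (Suc i))" for a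
    unfolding shift_def digit_ternary_code using ternary_code_head[of a] by simp
  have "(shift ^^ k) (ternary_code b) = ternary_code (\<lambda>i. b (i + k))"
    by (induction k) (simp_all add: tail)
  then show ?thesis by (simp add: digit_ternary_code)
qed

lemma continuous_digit_shift: "continuous_on UNIV (\<lambda>t. digit ((shift ^^ k) t))"
proof -
  have d: "continuous_on UNIV digit" and s: "continuous_on UNIV shift"
    unfolding digit_def shift_def by (intro continuous_intros)+
  have "continuous_on UNIV (\<lambda>t. (shift ^^ k) t)"
  proof (induction k)
    case (Suc k)
    have "continuous_on UNIV (\<lambda>t. shift ((shift ^^ k) t))"
      by (rule continuous_on_compose2[OF s Suc]) simp
    then show ?case by simp
  qed simp
  then show ?thesis by (rule continuous_on_compose2[OF d]) simp
qed

lemma digit_bounds: "0 \<le> digit t" "digit t \<le> 1"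
  by (auto simp: digit_def)

text \<open>
  The digits are continuous functions of the code, so weak convergence of the laws of the codes, which
  Helly's theorem provides along a subsequence, gives convergence of the expectations of products of
  digits, that is, of the probabilities of finite intersections.
\<close>

lemma event_sequence_limit:
  fixes M :: "nat \<Rightarrow> 'a measure" and C :: "nat \<Rightarrow> 'a set"
  assumes prob: "\<And>n. prob_space (M n)" and C: "\<And>n k. C k \<in> sets (M n)"
  obtains s \<kappa> E where "strict_mono (s :: nat \<Rightarrow> nat)" "real_distribution \<kappa>"
    "\<And>k. E k \<in> sets borel"
    "\<And>J. finite J \<Longrightarrow> (\<lambda>n. measure (M (s n)) {p \<in> space (M (s n)). \<forall>k\<in>J. p \<in> C k})
       \<longlonglongrightarrow> measure \<kappa> {\<omega>. \<forall>k\<in>J. \<omega> \<in> E k}"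
proof -
  note [measurable] = C
  define h where "h p = ternary_code (\<lambda>k. p \<in> C k)" for p
  have h[measurable]: "h \<in> borel_measurable (M n)" for n
    unfolding h_def ternary_code_def by measurable
  have h_range: "h p \<in> {-1<..1}" for p
    using ternary_code_nonneg[of "\<lambda>k. p \<in> C k"] ternary_code_le[of "\<lambda>k. p \<in> C k"] by (auto simp: h_def)
  let ?D = "\<lambda>n. distr (M n) borel h"
  have rd: "real_distribution (?D n)" for n
    using prob by (simp add: real_distribution_def real_distribution_axioms_def prob_space.prob_space_distr)
  have "tight ?D"
    unfolding tight_def
  proof (intro conjI allI impI)
    fix e :: real assume "e > 0"
    have "measure (?D n) {-1<..1} = 1" for n
      using h_range prob_space.prob_space[OF prob, of n]
      by (subst measure_distr) (auto simp: vimage_def)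
    then show "\<exists>a b. a < b \<and> (\<forall>n. 1 - e < measure (?D n) {a<..b})"
      using \<open>e > 0\<close> by (intro exI[of _ "-1"] exI[of _ 1]) auto
  qed (rule rd)
  from tight_imp_convergent_subsubsequence[OF this, of id]
  obtain s \<kappa> where s: "strict_mono s" and \<kappa>: "real_distribution \<kappa>"
    and wc: "weak_conv_m (\<lambda>n. ?D (s n)) \<kappa>"
    by (auto simp: strict_mono_def comp_def)
  interpret \<kappa>: real_distribution \<kappa> by fact
  define d where "d k t = digit ((shift ^^ k) t)" for k t
  have d_h: "d k (h p) = of_bool (p \<in> C k)" for k p
    by (simp add: d_def h_def digit_shift_ternary_code)
  have d_cont: "continuous_on UNIV (d k)" for k
    unfolding d_def by (rule continuous_digit_shift)
  have d_meas[measurable]: "d k \<in> borel_measurable borel" for k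
    by (rule borel_measurable_continuous_onI[OF d_cont])
  have d_bd: "0 \<le> d k t" "d k t \<le> 1" for k t
    by (auto simp: d_def digit_bounds)
  have lim: "(\<lambda>n. \<integral>p. f (h p) \<partial>M (s n)) \<longlonglongrightarrow> integral\<^sup>L \<kappa> f"
    if f: "continuous_on UNIV f" "\<And>x. norm (f x) \<le> 1" for f :: "real \<Rightarrow> real"
  proof -
    have "(\<lambda>n. integral\<^sup>L (?D (s n)) f) \<longlonglongrightarrow> integral\<^sup>L \<kappa> f"
      by (rule weak_conv_imp_integral_bdd_continuous_conv[OF rd \<kappa> wc _ f(2)])
         (use f(1) in \<open>simp add: continuous_on_eq_continuous_at\<close>)
    moreover have "f \<in> borel_measurable borel"
      by (rule borel_measurable_continuous_onI[OF f(1)])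
    ultimately show ?thesis by (simp add: integral_distr)
  qed
  \<comment> \<open>Off the codes a digit can take any value in \<open>[0,1]\<close>, but the limit law does not see this.\<close>
  have d01: "AE t in \<kappa>. d k t = of_bool (d k t = 1)" for k
  proof -
    have "(\<lambda>n. \<integral>p. d k (h p) * (1 - d k (h p)) \<partial>M (s n)) \<longlonglongrightarrow> (\<integral>t. d k t * (1 - d k t) \<partial>\<kappa>)"
      by (rule lim) (auto intro!: continuous_intros d_cont mult_le_one simp: d_bd)
    moreover have "d k (h p) * (1 - d k (h p)) = 0" for p
      by (simp add: d_h)
    ultimately have "(\<integral>t. d k t * (1 - d k t) \<partial>\<kappa>) = 0"
      by (simp add: LIMSEQ_const_iff)
    then have "AE t in \<kappa>. d k t * (1 - d k t) = 0"
      by (subst (asm) integral_nonneg_eq_0_iff_AE)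
         (auto intro!: \<kappa>.integrable_const_bound[of _ 1] simp: d_bd abs_mult mult_le_one)
    then show ?thesis by eventually_elim auto
  qed
  define E where "E k = {t. d k t = 1}" for k
  have E[measurable]: "E k \<in> sets borel" for k
    unfolding E_def by measurable
  show ?thesis
  proof (rule that[OF s \<kappa> E])
    fix J :: "nat set" assume J: "finite J"
    have "(\<lambda>n. \<integral>p. (\<Prod>k\<in>J. d k (h p)) \<partial>M (s n)) \<longlonglongrightarrow> (\<integral>t. (\<Prod>k\<in>J. d k t) \<partial>\<kappa>)"
      by (rule lim) (auto intro!: continuous_intros continuous_on_prod d_cont prod_le_1 simp: d_bd abs_prod)
    moreover have "(\<integral>p. (\<Prod>k\<in>J. d k (h p)) \<partial>M (s n))
        = measure (M (s n)) {p \<in> space (M (s n)). \<forall>k\<in>J. p \<in> C k}" for n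
    proof -
      have "(\<Prod>k\<in>J. d k (h p)) = indicator {p \<in> space (M (s n)). \<forall>k\<in>J. p \<in> C k} p"
        if "p \<in> space (M (s n))" for p
        using J that by (auto simp: d_h indicator_def intro!: prod.neutral)
      then have "(\<integral>p. (\<Prod>k\<in>J. d k (h p)) \<partial>M (s n))
          = (\<integral>p. indicator {p \<in> space (M (s n)). \<forall>k\<in>J. p \<in> C k} p \<partial>M (s n))"
        by (intro Bochner_Integration.integral_cong) auto
      then show ?thesis by (simp add: Int_absorb2)
    qed
    moreover have "(\<integral>t. (\<Prod>k\<in>J. d k t) \<partial>\<kappa>) = measure \<kappa> {\<omega>. \<forall>k\<in>J. \<omega> \<in> E k}"
    proof -
      have "AE t in \<kappa>. \<forall>k\<in>J. d k t = of_bool (d k t = 1)"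
        using J d01 by (simp add: AE_finite_all)
      then have "AE t in \<kappa>. (\<Prod>k\<in>J. d k t) = indicator {\<omega>. \<forall>k\<in>J. \<omega> \<in> E k} t"
      proof eventually_elim
        case (elim t)
        then have "(\<Prod>k\<in>J. d k t) = (\<Prod>k\<in>J. of_bool (t \<in> E k))"
          unfolding E_def by (intro prod.cong) auto
        then show ?case
          using J by (auto simp: indicator_def intro!: prod.neutral)
      qed
      moreover have [measurable]: "{\<omega>. \<forall>k\<in>J. \<omega> \<in> E k} \<in> sets borel"
        using J by measurable
      ultimately have "(\<integral>t. (\<Prod>k\<in>J. d k t) \<partial>\<kappa>) = (\<integral>t. indicator {\<omega>. \<forall>k\<in>J. \<omega> \<in> E k} t \<partial>\<kappa>)"
        by (intro integral_cong_AE) measurable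
      then show ?thesis by simp
    qed
    ultimately show "(\<lambda>n. measure (M (s n)) {p \<in> space (M (s n)). \<forall>k\<in>J. p \<in> C k})
       \<longlonglongrightarrow> measure \<kappa> {\<omega>. \<forall>k\<in>J. \<omega> \<in> E k}" by simp
  qed
qed

section \<open>Points described by the balls that contain them\<close>

text \<open>
  Balls of arbitrarily small radius cover the space, so a point is determined by the balls that contain
  it.
\<close>

definition fine_balls :: "(nat \<Rightarrow> 'a::metric_space) \<Rightarrow> (nat \<Rightarrow> real) \<Rightarrow> bool" where
  "fine_balls z r \<longleftrightarrow> (\<forall>x. \<forall>e>0. \<exists>j. r j < e \<and> x \<in> ball (z j) (r j))"

definition membership :: "(nat \<Rightarrow> 'a set) \<Rightarrow> 'a \<Rightarrow> nat \<Rightarrow> bool" where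
  "membership A x j \<longleftrightarrow> x \<in> A j"

text \<open>
  The generating sets only prescribe that some events occur, never that some fail. They are closed under
  intersection and match the quantities that \<open>event_sequence_limit\<close> controls.
\<close>

definition membership_space :: "(nat \<Rightarrow> bool) measure" where
  "membership_space = sigma UNIV {{b. \<forall>j\<in>J. b j} | J. finite J}"

lemma space_membership_space[simp]: "space membership_space = UNIV"
  by (simp add: membership_space_def space_measure_of_conv)

lemma measurable_membership_coordinate[measurable]:
  "Measurable.pred membership_space (\<lambda>b. b j)"
proof -
  have "{b. b j} \<in> {{b. \<forall>j\<in>J. b j} | J. finite J}"
    by (intro CollectI exI[of _ "{j}"]) auto
  then show ?thesis
    unfolding pred_def membership_space_def by (auto simp: space_measure_of_conv)
qed

lemma measurable_membership:
  assumes "\<And>j. A j \<in> sets M"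
  shows "membership A \<in> measurable M membership_space"
  unfolding membership_space_def
proof (rule measurable_measure_of)
  fix S :: "(nat \<Rightarrow> bool) set" assume "S \<in> {{b. \<forall>j\<in>J. b j} | J. finite J}"
  then obtain J where J: "finite J" "S = {b. \<forall>j\<in>J. b j}" by blast
  then have "membership A -` S \<inter> space M = {x \<in> space M. \<forall>j\<in>J. x \<in> A j}"
    by (auto simp: membership_def)
  also have "\<dots> \<in> sets M" using J(1) assms by measurable
  finally show "membership A -` S \<inter> space M \<in> sets M" .
qed auto

lemma distr_membership_eqI:
  assumes M: "prob_space M" and N: "prob_space N"
    and A: "\<And>j. A j \<in> sets M" and B: "\<And>j. B j \<in> sets N"
    and eq: "\<And>J. finite J \<Longrightarrow> measure M {x \<in> space M. \<forall>j\<in>J. x \<in> A j} = measure N {x \<in> space N. \<forall>j\<in>J. x \<in> B j}"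
  shows "distr M membership_space (membership A) = distr N membership_space (membership B)"
proof -
  interpret M: prob_space M by fact
  interpret N: prob_space N by fact
  let ?C = "{{b. \<forall>j\<in>J. b j} | J :: nat set. finite J}"
  have C_sub: "?C \<subseteq> sets membership_space"
    unfolding membership_space_def by auto
  show ?thesis
  proof (rule measure_eqI_generator_eq[where E = ?C and \<Omega> = UNIV and A = "\<lambda>_. UNIV"])
    show "Int_stable ?C"
      unfolding Int_stable_def
    proof (intro ballI)
      fix S T assume "S \<in> ?C" "T \<in> ?C"
      then obtain J K where "finite J" "finite K" "S = {b. \<forall>j\<in>J. b j}" "T = {b. \<forall>j\<in>K. b j}"
        by blast
      then show "S \<inter> T \<in> ?C" by (intro CollectI exI[of _ "J \<union> K"]) auto
    qed
    show "range (\<lambda>_. UNIV) \<subseteq> ?C" by (auto intro!: exI[of _ "{}"])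
    show "emeasure (distr M membership_space (membership A)) UNIV \<noteq> \<infinity>"
      using prob_space.prob_space_distr[OF M measurable_membership[OF A]]
      by (simp add: prob_space.emeasure_space_1 prob_space_imp_subprob_space subprob_space.emeasure_subprob_space_less_top less_top[symmetric] emeasure_distr measurable_membership[OF A])
    fix S assume S: "S \<in> ?C"
    then obtain J where J: "finite J" "S = {b. \<forall>j\<in>J. b j}" by blast
    have "emeasure (distr M membership_space (membership A)) S = emeasure M {x \<in> space M. \<forall>j\<in>J. x \<in> A j}"
      using C_sub S J measurable_membership[OF A]
      by (subst emeasure_distr) (auto simp: membership_def intro!: arg_cong[where f = "emeasure M"])
    moreover have "emeasure (distr N membership_space (membership B)) S = emeasure N {x \<in> space N. \<forall>j\<in>J. x \<in> B j}"
      using C_sub S J measurable_membership[OF B]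
      by (subst emeasure_distr) (auto simp: membership_def intro!: arg_cong[where f = "emeasure N"])
    ultimately show "emeasure (distr M membership_space (membership A)) S = emeasure (distr N membership_space (membership B)) S"
      using eq[OF J(1)] by (simp add: M.emeasure_eq_measure N.emeasure_eq_measure)
  qed (auto simp: membership_space_def)
qed

text \<open>
  The centres of the first ball of radius less than \<open>1/(k+1)\<close> in the pattern of a point converge to that
  point as \<open>k\<close> grows. On patterns whose centres do not form a Cauchy sequence the value is arbitrary.
\<close>

lemma fine_balls_decoder:
  fixes z :: "nat \<Rightarrow> 'a::polish_space"
  assumes fine: "fine_balls z r"
  obtains G where "G \<in> borel_measurable membership_space"
    "\<And>x. G (membership (\<lambda>j. ball (z j) (r j)) x) = x"
proof -
  define g where "g k b = z (LEAST j. b j \<and> r j < 1 / real (Suc k))" for k b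
  have [measurable]: "g k \<in> borel_measurable membership_space" for k
    unfolding g_def by measurable
  define g' where "g' k b = (if Cauchy (\<lambda>i. g i b) then g k b else z 0)" for k b
  have m[measurable]: "g' k \<in> borel_measurable membership_space" for k
    unfolding g'_def by measurable
  have conv: "(\<lambda>k. g' k b) \<longlonglongrightarrow> lim (\<lambda>k. g' k b)" for b
    unfolding g'_def by (cases "Cauchy (\<lambda>i. g i b)") (auto simp: Cauchy_convergent_iff convergent_LIMSEQ_iff)
  show ?thesis
  proof (rule that[of "\<lambda>b. lim (\<lambda>k. g' k b)"])
    show "(\<lambda>b. lim (\<lambda>k. g' k b)) \<in> borel_measurable membership_space"
      by (rule borel_measurable_LIMSEQ_metric[OF m conv])
    fix x
    let ?b = "membership (\<lambda>j. ball (z j) (r j)) x"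
    have near: "dist (g k ?b) x < 1 / real (Suc k)" for k
    proof -
      have "\<exists>j. ?b j \<and> r j < 1 / real (Suc k)"
        using fine unfolding fine_balls_def membership_def by (meson of_nat_0_less_iff zero_less_Suc zero_less_divide_1_iff)
      from LeastI_ex[OF this] show ?thesis
        unfolding g_def by (simp add: membership_def)
    qed
    have "(\<lambda>k. g k ?b) \<longlonglongrightarrow> x"
    proof (rule metric_tendsto_imp_tendsto[OF LIMSEQ_inverse_real_of_nat])
      show "\<forall>\<^sub>F k in sequentially. dist (g k ?b) x \<le> dist (inverse (real (Suc k))) 0"
        using near by (intro always_eventually) (simp add: inverse_eq_divide less_imp_le)
    qed
    moreover from this have "Cauchy (\<lambda>k. g k ?b)" by (rule LIMSEQ_imp_Cauchy)
    ultimately show "lim (\<lambda>k. g' k ?b) = x"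
      unfolding g'_def by (simp add: limI)
  qed
qed

text \<open>
  Call a pattern good if decoding it to a point and encoding that point returns the pattern. This is a
  measurable condition, and the patterns of points are good; hence every random pattern with the law of
  the pattern of a \<open>\<mu>\<close>-distributed point is almost surely good, and can be replaced by its point.
\<close>

lemma random_point_with_membership:
  fixes \<mu> :: "'a::polish_space measure" and \<kappa> :: "'w measure"
  assumes fine: "fine_balls z r" and \<mu>: "\<mu> \<in> borel_probs" and \<kappa>: "prob_space \<kappa>"
    and E: "\<And>j. E j \<in> sets \<kappa>"
    and eq: "\<And>J. finite J \<Longrightarrow> measure \<kappa> {w \<in> space \<kappa>. \<forall>j\<in>J. w \<in> E j} = measure \<mu> {x. \<forall>j\<in>J. x \<in> ball (z j) (r j)}"
  obtains G where "G \<in> borel_measurable \<kappa>" "distr \<kappa> borel G = \<mu>"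
    "AE w in \<kappa>. \<forall>j. w \<in> E j \<longleftrightarrow> G w \<in> ball (z j) (r j)"
proof -
  obtain g where g[measurable]: "g \<in> borel_measurable membership_space"
    and g_inv: "\<And>x. g (membership (\<lambda>j. ball (z j) (r j)) x) = x"
    using fine_balls_decoder[OF fine] by blast
  note \<mu>' = borel_probsD[OF \<mu>]
  let ?A = "\<lambda>j. ball (z j) (r j)"
  have A: "?A j \<in> sets \<mu>" for j using \<mu>' by simp
  note mE[measurable] = measurable_membership[OF E] and mA[measurable] = measurable_membership[OF A]
  have D: "distr \<kappa> membership_space (membership E) = distr \<mu> membership_space (membership ?A)"
    by (rule distr_membership_eqI[OF \<kappa> \<mu>'(1) E A]) (simp add: eq \<mu>'(3))
  show ?thesis
  proof (rule that[of "\<lambda>w. g (membership E w)"])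
    show "(\<lambda>w. g (membership E w)) \<in> borel_measurable \<kappa>" by measurable
    have "distr \<kappa> borel (\<lambda>w. g (membership E w)) = distr (distr \<kappa> membership_space (membership E)) borel g"
      by (simp add: distr_distr comp_def)
    also have "\<dots> = distr \<mu> borel (\<lambda>x. x)"
      unfolding D by (simp add: distr_distr comp_def g_inv)
    also have "\<dots> = \<mu>"
      using distr_id2[of borel \<mu>] \<mu>'(2) by simp
    finally show "distr \<kappa> borel (\<lambda>w. g (membership E w)) = \<mu>" .
    let ?P = "\<lambda>b. \<forall>j. b j \<longleftrightarrow> dist (z j) (g b) < r j"
    have P[measurable]: "Measurable.pred membership_space ?P" by measurable
    have "AE x in \<mu>. ?P (membership ?A x)"
      unfolding g_inv by (simp add: membership_def)
    then have "AE b in distr \<mu> membership_space (membership ?A). ?P b"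
      using P mA by (subst AE_distr_iff) (simp_all add: pred_def)
    then have "AE w in \<kappa>. ?P (membership E w)"
      using P mE unfolding D[symmetric] by (subst (asm) AE_distr_iff) (simp_all add: pred_def)
    then show "AE w in \<kappa>. \<forall>j. w \<in> E j \<longleftrightarrow> g (membership E w) \<in> ?A j"
      by eventually_elim (auto simp: membership_def)
  qed
qed

text \<open>
  The spheres around a point are disjoint, so only countably many of them have positive mass.
\<close>

lemma null_sphere_radius:
  fixes z :: "'a::metric_space"
  assumes \<mu>: "\<mu> \<in> borel_probs" and ab: "a < b"
  shows "\<exists>r. a < r \<and> r < b \<and> measure \<mu> {x. dist z x = r} = 0"
proof -
  note \<mu>' = borel_probsD[OF \<mu>]
  have [measurable]: "dist z \<in> borel_measurable \<mu>"
    unfolding measurable_cong_sets[OF \<mu>'(2) refl]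
    by (intro borel_measurable_continuous_onI continuous_intros)
  interpret D: prob_space "distr \<mu> borel (dist z)"
    by (rule prob_space.prob_space_distr[OF \<mu>'(1)]) measurable
  have "uncountable ({a<..<b} - {r. measure (distr \<mu> borel (dist z)) {r} \<noteq> 0})"
    using ab D.countable_support by (intro uncountable_minus_countable) (auto simp: uncountable_open_interval)
  then have "{a<..<b} - {r. measure (distr \<mu> borel (dist z)) {r} \<noteq> 0} \<noteq> {}"
    by (metis countable_empty)
  then obtain r where "r \<in> {a<..<b}" "measure (distr \<mu> borel (dist z)) {r} = 0"
    by blast
  then show ?thesis
    using \<mu>'(3) by (intro exI[of _ r]) (simp add: measure_distr vimage_def)
qed

lemma fine_balls_exist:
  fixes \<mu> :: "'a::{metric_space, second_countable_topology} measure"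
  assumes \<mu>: "\<mu> \<in> borel_probs"
  obtains z r where "fine_balls z r" "\<And>j. measure \<mu> {x. dist (z j) x = r j} = 0"
proof -
  obtain D :: "'a set" where D: "countable D" "\<And>X. open X \<Longrightarrow> X \<noteq> {} \<Longrightarrow> \<exists>d\<in>D. d \<in> X"
    using countable_dense_setE by blast
  have "D \<noteq> {}" using D(2)[of UNIV] by auto
  define z where "z j = from_nat_into D (fst (prod_decode j))" for j
  define k where "k j = real (Suc (snd (prod_decode j)))" for j
  \<comment> \<open>A centre within distance \<open>1 / (2 k)\<close> of a point then gives a ball around that point.\<close>
  have "\<exists>r. 1 / (2 * k j) < r \<and> r < 1 / k j \<and> measure \<mu> {x. dist (z j) x = r} = 0" for j
    by (rule null_sphere_radius[OF \<mu>]) (simp add: k_def divide_simps)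
  then obtain r where r: "\<And>j. 1 / (2 * k j) < r j" "\<And>j. r j < 1 / k j"
      "\<And>j. measure \<mu> {x. dist (z j) x = r j} = 0"
    by metis
  show ?thesis
  proof (rule that[OF _ r(3)])
    show "fine_balls z r"
      unfolding fine_balls_def
    proof (intro allI impI)
      fix x :: 'a and e :: real assume "e > 0"
      then obtain n where n: "1 / real (Suc n) < e" using nat_approx_posE by metis
      obtain d where d: "d \<in> D" "dist d x < 1 / (2 * real (Suc n))"
        using D(2)[of "ball x (1 / (2 * real (Suc n)))"]
        by (metis centre_in_ball dist_commute empty_iff mem_ball of_nat_0_less_iff open_ball zero_less_Suc
            zero_less_divide_1_iff zero_less_mult_iff zero_less_numeral)
      then obtain i where i: "from_nat_into D i = d"
        using from_nat_into_surj[OF D(1) d(1)] by blast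
      let ?j = "prod_encode (i, n)"
      have "r ?j < e" using r(2)[of ?j] n by (simp add: k_def)
      moreover have "x \<in> ball (z ?j) (r ?j)"
        using r(1)[of ?j] d i by (simp add: k_def z_def)
      ultimately show "\<exists>j. r j < e \<and> x \<in> ball (z j) (r j)" by blast
    qed
  qed
qed

lemma weak_conv_to_ball_intersection:
  fixes \<mu> :: "'a::metric_space measure" and z :: "nat \<Rightarrow> 'a"
  assumes wc: "weak_conv_to M \<mu>" and M: "\<And>n. M n \<in> borel_probs" and \<mu>: "\<mu> \<in> borel_probs"
    and null: "\<And>j. measure \<mu> {x. dist (z j) x = r j} = 0" and J: "finite J"
  shows "(\<lambda>n. measure (M n) {x. \<forall>j\<in>J. x \<in> ball (z j) (r j)}) \<longlonglongrightarrow> measure \<mu> {x. \<forall>j\<in>J. x \<in> ball (z j) (r j)}"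
proof (rule weak_conv_to_continuity_set[OF wc M \<mu>, where F = "\<Inter>j\<in>J. cball (z j) (r j)"])
  note \<mu>' = borel_probsD[OF \<mu>]
  interpret prob_space \<mu> by (rule \<mu>')
  have e: "{x. \<forall>j\<in>J. x \<in> ball (z j) (r j)} = (\<Inter>j\<in>J. ball (z j) (r j))" by auto
  show o: "open {x. \<forall>j\<in>J. x \<in> ball (z j) (r j)}"
    unfolding e using J by (intro open_INT) auto
  show c: "closed (\<Inter>j\<in>J. cball (z j) (r j))" by (intro closed_INT) auto
  show "{x. \<forall>j\<in>J. x \<in> ball (z j) (r j)} \<subseteq> (\<Inter>j\<in>J. cball (z j) (r j))" by auto
  have "AE x in \<mu>. dist (z j) x \<noteq> r j" for j
  proof (rule AE_I)
    have "closed {x. dist (z j) x = r j}"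
      by (intro closed_Collect_eq continuous_intros)
    then show "{x. dist (z j) x = r j} \<in> sets \<mu>" by (simp add: \<mu>')
    show "emeasure \<mu> {x. dist (z j) x = r j} = 0" using null by (simp add: emeasure_eq_measure)
  qed auto
  then have "AE x in \<mu>. \<forall>j. dist (z j) x \<noteq> r j" by (simp add: AE_all_countable)
  then have "AE x in \<mu>. x \<in> (\<Inter>j\<in>J. cball (z j) (r j)) \<longleftrightarrow> x \<in> {x. \<forall>j\<in>J. x \<in> ball (z j) (r j)}"
    by eventually_elim (auto simp: less_le)
  then show "measure \<mu> (\<Inter>j\<in>J. cball (z j) (r j)) = measure \<mu> {x. \<forall>j\<in>J. x \<in> ball (z j) (r j)}"
    by (rule measure_eq_AE) (use o c \<mu>' in \<open>simp_all only: borel_open borel_closed\<close>)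
qed

section \<open>Subsequential limits of couplings\<close>

lemma couplingsD:
  assumes "\<pi> \<in> couplings \<mu> \<nu>"
  shows "\<pi> \<in> borel_probs" "distr \<pi> borel fst = \<mu>" "distr \<pi> borel snd = \<nu>"
  using assms by (auto simp: couplings_def)

lemma couplings_measure:
  fixes \<pi> :: "('a::topological_space \<times> 'b::topological_space) measure"
  assumes "\<pi> \<in> couplings \<mu> \<nu>"
  shows "A \<in> sets borel \<Longrightarrow> measure \<pi> {p. fst p \<in> A} = measure \<mu> A"
    and "B \<in> sets borel \<Longrightarrow> measure \<pi> {p. snd p \<in> B} = measure \<nu> B"
proof -
  note c = couplingsD[OF assms]
  note b = borel_probsD[OF c(1)]
  have m: "fst \<in> borel_measurable \<pi>" "snd \<in> borel_measurable \<pi>"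
    unfolding measurable_cong_sets[OF b(2) refl]
    by (intro borel_measurable_continuous_onI continuous_intros)+
  show "A \<in> sets borel \<Longrightarrow> measure \<pi> {p. fst p \<in> A} = measure \<mu> A"
    unfolding c(2)[symmetric] using m by (simp add: measure_distr b vimage_def)
  show "B \<in> sets borel \<Longrightarrow> measure \<pi> {p. snd p \<in> B} = measure \<nu> B"
    unfolding c(3)[symmetric] using m by (simp add: measure_distr b vimage_def)
qed

text \<open>
  Even digits record membership of the first coordinate in balls, odd digits that of the second one. The
  marginals converge weakly and the spheres are null, so the even digits alone have the law that
  belongs to \<open>\<mu>\<close> and the odd digits alone the law that belongs to \<open>\<nu>\<close>; decoding both yields the
  limit coupling.
\<close>

lemma couplings_subsequence_limit:
  fixes \<mu> :: "'a::polish_space measure" and \<nu> :: "'b::polish_space measure"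
  assumes \<pi>n: "\<And>n. \<pi>n n \<in> couplings (\<mu>n n) (\<nu>n n)"
    and \<mu>n: "\<And>n. \<mu>n n \<in> borel_probs" and \<nu>n: "\<And>n. \<nu>n n \<in> borel_probs"
    and \<mu>: "\<mu> \<in> borel_probs" "weak_conv_to \<mu>n \<mu>"
    and \<nu>: "\<nu> \<in> borel_probs" "weak_conv_to \<nu>n \<nu>"
  obtains s \<pi> R where "strict_mono (s :: nat \<Rightarrow> nat)" "\<pi> \<in> couplings \<mu> \<nu>"
    "converge_on_base (\<lambda>n. \<pi>n (s n)) \<pi> R"
proof -
  obtain z r where zr: "fine_balls z r" "\<And>j. measure \<mu> {x. dist (z j) x = r j} = 0"
    using fine_balls_exist[OF \<mu>(1)] by metis
  obtain z' r' where zr': "fine_balls z' r'" "\<And>j. measure \<nu> {x. dist (z' j) x = r' j} = 0"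
    using fine_balls_exist[OF \<nu>(1)] by metis
  define A where "A j = ball (z j) (r j)" for j
  define B where "B j = ball (z' j) (r' j)" for j
  have AB_open: "open (A j)" "open (B j)" for j by (auto simp: A_def B_def)
  define C where "C k = (if even k then A (k div 2) \<times> UNIV else UNIV \<times> B (k div 2))" for k
  have C_open: "open (C k)" for k by (auto simp: C_def AB_open intro!: open_Times)
  \<comment> \<open>the digits that encode the event \<open>Q I J\<close> defined below\<close>
  define K where "K I J = (\<lambda>i. 2 * i) ` I \<union> (\<lambda>j. 2 * j + 1) ` J" for I J :: "nat set"
  have K_fin: "finite (K I J)" if "finite I" "finite J" for I J using that by (simp add: K_def)
  define Q where "Q I J = {p. (\<forall>i\<in>I. fst p \<in> A i) \<and> (\<forall>j\<in>J. snd p \<in> B j)}" for I J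
  have Q_C: "{p. \<forall>k\<in>K I J. p \<in> C k} = Q I J" for I J
  proof -
    have "C (2 * i) = A i \<times> UNIV" "C (2 * i + 1) = UNIV \<times> B i" for i
      by (simp_all add: C_def)
    then show ?thesis
      unfolding Q_def K_def ball_Un ball_simps by (simp add: mem_Times_iff)
  qed
  note b = borel_probsD[OF couplingsD(1)[OF \<pi>n]]
  obtain s \<kappa> E where s: "strict_mono (s :: nat \<Rightarrow> nat)" and \<kappa>: "real_distribution \<kappa>"
    and E: "\<And>k. E k \<in> sets borel"
    and lim: "\<And>J. finite J \<Longrightarrow> (\<lambda>n. measure (\<pi>n (s n)) {p \<in> space (\<pi>n (s n)). \<forall>k\<in>J. p \<in> C k})
       \<longlonglongrightarrow> measure \<kappa> {\<omega>. \<forall>k\<in>J. \<omega> \<in> E k}"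
    by (rule event_sequence_limit[of \<pi>n C, OF b(1)]) (use b(2) C_open in simp, rule that)
  interpret \<kappa>: real_distribution \<kappa> by fact
  have limQ: "(\<lambda>n. measure (\<pi>n (s n)) (Q I J)) \<longlonglongrightarrow> measure \<kappa> {\<omega>. (\<forall>i\<in>I. \<omega> \<in> E (2 * i)) \<and> (\<forall>j\<in>J. \<omega> \<in> E (2 * j + 1))}"
    if "finite I" "finite J" for I J
  proof -
    have "{\<omega>. \<forall>k\<in>K I J. \<omega> \<in> E k} = {\<omega>. (\<forall>i\<in>I. \<omega> \<in> E (2 * i)) \<and> (\<forall>j\<in>J. \<omega> \<in> E (2 * j + 1))}"
      by (auto simp: K_def)
    then show ?thesis using lim[OF K_fin[OF that]] by (simp add: b Q_C)
  qed
  have eqA: "measure \<kappa> {w \<in> space \<kappa>. \<forall>i\<in>I. w \<in> E (2 * i)} = measure \<mu> {x. \<forall>i\<in>I. x \<in> A i}"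
    if I: "finite I" for I
  proof -
    have "open (\<Inter>i\<in>I. A i)" using I AB_open by (intro open_INT) auto
    moreover have "{x. \<forall>i\<in>I. x \<in> A i} = (\<Inter>i\<in>I. A i)" by auto
    ultimately have "{x. \<forall>i\<in>I. x \<in> A i} \<in> sets borel" by simp
    from couplings_measure(1)[OF \<pi>n this]
    have "measure (\<pi>n n) (Q I {}) = measure (\<mu>n n) {x. \<forall>i\<in>I. x \<in> A i}" for n
      by (simp add: Q_def)
    moreover have "(\<lambda>n. measure (\<mu>n (s n)) {x. \<forall>i\<in>I. x \<in> A i}) \<longlonglongrightarrow> measure \<mu> {x. \<forall>i\<in>I. x \<in> A i}"
      using LIMSEQ_subseq_LIMSEQ[OF weak_conv_to_ball_intersection[OF \<mu>(2) \<mu>n \<mu>(1) zr(2) I] s]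
      by (simp add: A_def comp_def)
    ultimately show ?thesis
      using LIMSEQ_unique[OF limQ[OF I finite.emptyI]] by simp
  qed
  have eqB: "measure \<kappa> {w \<in> space \<kappa>. \<forall>i\<in>I. w \<in> E (2 * i + 1)} = measure \<nu> {x. \<forall>i\<in>I. x \<in> B i}"
    if I: "finite I" for I
  proof -
    have "open (\<Inter>i\<in>I. B i)" using I AB_open by (intro open_INT) auto
    moreover have "{x. \<forall>i\<in>I. x \<in> B i} = (\<Inter>i\<in>I. B i)" by auto
    ultimately have "{x. \<forall>i\<in>I. x \<in> B i} \<in> sets borel" by simp
    from couplings_measure(2)[OF \<pi>n this]
    have "measure (\<pi>n n) (Q {} I) = measure (\<nu>n n) {x. \<forall>i\<in>I. x \<in> B i}" for n
      by (simp add: Q_def)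
    moreover have "(\<lambda>n. measure (\<nu>n (s n)) {x. \<forall>i\<in>I. x \<in> B i}) \<longlonglongrightarrow> measure \<nu> {x. \<forall>i\<in>I. x \<in> B i}"
      using LIMSEQ_subseq_LIMSEQ[OF weak_conv_to_ball_intersection[OF \<nu>(2) \<nu>n \<nu>(1) zr'(2) I] s]
      by (simp add: B_def comp_def)
    ultimately show ?thesis
      using LIMSEQ_unique[OF limQ[OF finite.emptyI I]] by simp
  qed
  obtain G where G[measurable]: "G \<in> borel_measurable \<kappa>" and Gd: "distr \<kappa> borel G = \<mu>"
    and GE: "AE w in \<kappa>. \<forall>j. w \<in> E (2 * j) \<longleftrightarrow> G w \<in> A j"
    using random_point_with_membership[OF zr(1) \<mu>(1) \<kappa>.prob_space_axioms, of "\<lambda>j. E (2 * j)"] E eqA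
    unfolding A_def by auto
  obtain H where H[measurable]: "H \<in> borel_measurable \<kappa>" and Hd: "distr \<kappa> borel H = \<nu>"
    and HE: "AE w in \<kappa>. \<forall>j. w \<in> E (2 * j + 1) \<longleftrightarrow> H w \<in> B j"
    using random_point_with_membership[OF zr'(1) \<nu>(1) \<kappa>.prob_space_axioms, of "\<lambda>j. E (2 * j + 1)"] E eqB
    unfolding B_def by auto
  have GH[measurable]: "(\<lambda>w. (G w, H w)) \<in> borel_measurable \<kappa>"
    by (intro borel_measurable_Pair) measurable
  define \<pi> where "\<pi> = distr \<kappa> borel (\<lambda>w. (G w, H w))"
  have \<pi>p: "\<pi> \<in> borel_probs"
    unfolding \<pi>_def borel_probs_def using \<kappa>.prob_space_distr[OF GH] by simp
  have fs: "fst \<in> borel_measurable borel" "snd \<in> borel_measurable borel"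
    by (intro borel_measurable_continuous_onI continuous_intros)+
  have \<pi>c: "\<pi> \<in> couplings \<mu> \<nu>"
    using \<pi>p Gd Hd distr_distr[OF fs(1) GH] distr_distr[OF fs(2) GH] unfolding couplings_def
    by (simp add: \<pi>_def comp_def)
  have Q_open: "open (Q I J)" if "finite I" "finite J" for I J
  proof -
    have "Q I J = (\<Inter>i\<in>I. A i) \<times> (\<Inter>j\<in>J. B j)" by (auto simp: Q_def)
    then show ?thesis using that AB_open by (auto intro!: open_Times open_INT)
  qed
  have \<pi>Q: "measure \<pi> (Q I J) = measure \<kappa> {\<omega>. (\<forall>i\<in>I. \<omega> \<in> E (2 * i)) \<and> (\<forall>j\<in>J. \<omega> \<in> E (2 * j + 1))}"
    if IJ: "finite I" "finite J" for I J
  proof -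
    have "measure \<pi> (Q I J) = measure \<kappa> ((\<lambda>w. (G w, H w)) -` Q I J \<inter> space \<kappa>)"
      unfolding \<pi>_def using Q_open[OF IJ] by (intro measure_distr) auto
    also have "\<dots> = measure \<kappa> {\<omega>. (\<forall>i\<in>I. \<omega> \<in> E (2 * i)) \<and> (\<forall>j\<in>J. \<omega> \<in> E (2 * j + 1))}"
    proof (rule measure_eq_AE)
      show "AE x in \<kappa>. (x \<in> (\<lambda>w. (G w, H w)) -` Q I J \<inter> space \<kappa>) =
          (x \<in> {\<omega>. (\<forall>i\<in>I. \<omega> \<in> E (2 * i)) \<and> (\<forall>j\<in>J. \<omega> \<in> E (2 * j + 1))})"
        using GE HE by eventually_elim (auto simp: Q_def)
      show "(\<lambda>w. (G w, H w)) -` Q I J \<inter> space \<kappa> \<in> \<kappa>.events"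
        using Q_open[OF IJ] by (intro measurable_sets[OF GH]) auto
      have "{\<omega>. \<forall>k\<in>K I J. \<omega> \<in> E k} \<in> sets borel"
        using K_fin[OF IJ] E by measurable
      also have "{\<omega>. \<forall>k\<in>K I J. \<omega> \<in> E k} = {\<omega>. (\<forall>i\<in>I. \<omega> \<in> E (2 * i)) \<and> (\<forall>j\<in>J. \<omega> \<in> E (2 * j + 1))}"
        by (auto simp: K_def)
      finally show "{\<omega>. (\<forall>i\<in>I. \<omega> \<in> E (2 * i)) \<and> (\<forall>j\<in>J. \<omega> \<in> E (2 * j + 1))} \<in> \<kappa>.events"
        by simp
    qed
    finally show ?thesis .
  qed
  define R where "R = (\<lambda>(I, J). Q I J) ` (Collect finite \<times> Collect finite)"
  have R_open: "open S" if "S \<in> R" for S using that Q_open by (auto simp: R_def)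
  have "converge_on_base (\<lambda>n. \<pi>n (s n)) \<pi> R"
    unfolding converge_on_base_def
  proof (intro conjI ballI allI impI)
    show "countable R" unfolding R_def
      by (intro countable_image countable_SIGMA countable_Collect_finite)
    show "R \<subseteq> sets borel" using R_open by auto
    show "S \<inter> T \<in> R" if "S \<in> R" "T \<in> R" for S T
    proof -
      have "Q I J \<inter> Q I' J' = Q (I \<union> I') (J \<union> J')" for I J I' J' by (auto simp: Q_def)
      then show ?thesis using that by (fastforce simp: R_def)
    qed
    show "UNIV \<in> R" by (auto simp: R_def Q_def intro!: image_eqI[of _ _ "({}, {})"])
    show "(\<lambda>n. measure (\<pi>n (s n)) S) \<longlonglongrightarrow> measure \<pi> S" if "S \<in> R" for S
      using that limQ \<pi>Q by (auto simp: R_def)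
    fix U :: "('a \<times> 'b) set" assume U: "open U"
    have "U \<subseteq> \<Union>{S \<in> R. S \<subseteq> U}"
    proof
      fix p assume "p \<in> U"
      then obtain a b where ab: "open a" "open b" "p \<in> a \<times> b" "a \<times> b \<subseteq> U"
        using open_prod_elim[OF U] by metis
      obtain i where i: "fst p \<in> A i" "A i \<subseteq> a"
      proof -
        obtain e where e: "e > 0" "ball (fst p) e \<subseteq> a" using ab by (auto simp: open_contains_ball mem_Times_iff)
        obtain i where i: "r i < e / 2" "fst p \<in> A i"
          using zr(1) e(1) unfolding fine_balls_def A_def by (meson half_gt_zero)
        have "A i \<subseteq> ball (fst p) e"
        proof
          fix y assume "y \<in> A i"
          then show "y \<in> ball (fst p) e"
            using i dist_triangle2[of "fst p" y "z i"] by (auto simp: A_def dist_commute)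
        qed
        then show ?thesis using that i e by blast
      qed
      obtain j where j: "snd p \<in> B j" "B j \<subseteq> b"
      proof -
        obtain e where e: "e > 0" "ball (snd p) e \<subseteq> b" using ab by (auto simp: open_contains_ball mem_Times_iff)
        obtain i where i: "r' i < e / 2" "snd p \<in> B i"
          using zr'(1) e(1) unfolding fine_balls_def B_def by (meson half_gt_zero)
        have "B i \<subseteq> ball (snd p) e"
        proof
          fix y assume "y \<in> B i"
          then show "y \<in> ball (snd p) e"
            using i dist_triangle2[of "snd p" y "z' i"] by (auto simp: B_def dist_commute)
        qed
        then show ?thesis using that i e by blast
      qed
      have "Q {i} {j} \<in> R" by (auto simp: R_def intro!: image_eqI[of _ _ "({i}, {j})"])
      moreover have "Q {i} {j} = A i \<times> B j" by (auto simp: Q_def)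
      then have "p \<in> Q {i} {j}" "Q {i} {j} \<subseteq> U"
        using i j ab(4) by (auto simp: mem_Times_iff subset_iff)
      ultimately show "p \<in> \<Union>{S \<in> R. S \<subseteq> U}" by blast
    qed
    then show "\<exists>S\<subseteq>R. U = \<Union>S" by (intro exI[of _ "{S \<in> R. S \<subseteq> U}"]) auto
  qed
  from that[OF s \<pi>c this] show ?thesis .
qed

section \<open>Swap invariance\<close>

definition swap :: "('a \<times> 'b) \<times> ('a \<times> 'b) \<Rightarrow> ('a \<times> 'b) \<times> ('a \<times> 'b)" where
  "swap w = ((fst (fst w), snd (snd w)), (fst (snd w), snd (fst w)))"

definition excess :: "('a \<times> 'b \<Rightarrow> real) \<Rightarrow> ('a \<times> 'b) \<times> ('a \<times> 'b) \<Rightarrow> real" where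
  "excess c w = c (fst w) + c (snd w) - c (fst (swap w)) - c (snd (swap w))"

text \<open>
  Taking \<open>F\<close> to be \<open>G\<close> times \<open>exp (excess c / (2 \<epsilon>))\<close> turns this into the symmetric statement that the
  measure with density \<open>exp (excess c / (2 \<epsilon>))\<close> with respect to \<open>\<pi> \<otimes> \<pi>\<close> is invariant under \<open>swap\<close>. With
  \<open>\<pi> \<otimes> \<pi>\<close> itself on the left, null sets and marginals can be read off directly.
\<close>

definition swap_invariant ::
  "('a::topological_space \<times> 'b::topological_space \<Rightarrow> real) \<Rightarrow> real \<Rightarrow> ('a \<times> 'b) measure \<Rightarrow> bool" where
  "swap_invariant c \<epsilon> \<pi> \<longleftrightarrow>
     (\<forall>F :: _ \<Rightarrow> ennreal. F \<in> borel_measurable borel \<longrightarrow>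
        (\<integral>\<^sup>+w. F w \<partial>(\<pi> \<Otimes>\<^sub>M \<pi>)) = (\<integral>\<^sup>+w. F (swap w) * ennreal (exp (excess c w / \<epsilon>)) \<partial>(\<pi> \<Otimes>\<^sub>M \<pi>)))"

lemma swap_invariantD:
  assumes "swap_invariant c \<epsilon> \<pi>" "F \<in> borel_measurable borel"
  shows "(\<integral>\<^sup>+w. F w \<partial>(\<pi> \<Otimes>\<^sub>M \<pi>)) = (\<integral>\<^sup>+w. F (swap w) * ennreal (exp (excess c w / \<epsilon>)) \<partial>(\<pi> \<Otimes>\<^sub>M \<pi>))"
  using assms by (simp add: swap_invariant_def)

lemma swap_swap[simp]: "swap (swap w) = w"
  by (simp add: swap_def)

lemma excess_swap[simp]: "excess c (swap w) = - excess c w"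
  by (simp add: excess_def)

lemma continuous_on_swap: "continuous_on UNIV (swap :: ('a::topological_space \<times> 'b::topological_space) \<times> _ \<Rightarrow> _)"
  unfolding swap_def by (intro continuous_intros)

lemma measurable_swap[measurable]:
  "(swap :: ('a::topological_space \<times> 'b::topological_space) \<times> _ \<Rightarrow> _) \<in> borel_measurable borel"
  by (rule borel_measurable_continuous_onI[OF continuous_on_swap])

lemma measurable_fst_borel: "fst \<in> borel_measurable (borel :: ('a::topological_space \<times> 'b::topological_space) measure)"
  and measurable_snd_borel: "snd \<in> borel_measurable (borel :: ('a::topological_space \<times> 'b::topological_space) measure)"
  by (intro borel_measurable_continuous_onI continuous_intros)+

lemma measurable_excess:
  assumes [measurable]: "c \<in> borel_measurable borel"
  shows "excess c \<in> borel_measurable borel"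
proof -
  note [measurable] = measurable_fst_borel measurable_snd_borel
  show ?thesis unfolding excess_def by measurable
qed

lemma continuous_on_excess:
  assumes "continuous_on UNIV c"
  shows "continuous_on UNIV (excess c)"
  unfolding excess_def swap_def
  by (intro continuous_intros continuous_on_compose2[OF assms]) auto

text \<open>
  The case of cycles of length two.
\<close>

lemma cyclically_invariant_two:
  assumes cyc: "\<forall>k\<ge>1. \<forall>(x :: nat \<Rightarrow> 'x) (y :: nat \<Rightarrow> 'y). y (k + 1) = y 1 \<longrightarrow>
           (\<Prod>i=1..k. Z (x i, y i)) =
             exp (- (1 / \<epsilon>) * ((\<Sum>i=1..k. c (x i, y i)) - (\<Sum>i=1..k. c (x i, y (i + 1))))) *
             (\<Prod>i=1..k. Z (x i, y (i + 1)))"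
  shows "Z (fst w) * Z (snd w) = exp (- excess c w / \<epsilon>) * (Z (fst (swap w)) * Z (snd (swap w)) :: real)"
proof -
  define x where "x i = (if i = (1::nat) then fst (fst w) else fst (snd w))" for i
  define y where "y i = (if i = (2::nat) then snd (snd w) else snd (fst w))" for i
  have "{1..2::nat} = {1, 2}" by auto
  then have "Z (fst w) * Z (snd w) = exp (- (1 / \<epsilon>) * excess c w) * (Z (fst (swap w)) * Z (snd (swap w)))"
    using cyc[rule_format, of 2 y x] by (simp add: x_def y_def excess_def swap_def algebra_simps)
  then show ?thesis by simp
qed

context
  fixes \<mu> :: "'a::second_countable_topology measure" and \<nu> :: "'b::second_countable_topology measure"
  assumes \<mu>: "\<mu> \<in> borel_probs" and \<nu>: "\<nu> \<in> borel_probs"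
begin

text \<open>
  In this order of integration the two variables that \<open>swap\<close> exchanges are adjacent.
\<close>

lemma nn_integral_pair_pair:
  assumes F: "F \<in> borel_measurable ((\<mu> \<Otimes>\<^sub>M \<nu>) \<Otimes>\<^sub>M (\<mu> \<Otimes>\<^sub>M \<nu>))"
  shows "(\<integral>\<^sup>+w. F w \<partial>((\<mu> \<Otimes>\<^sub>M \<nu>) \<Otimes>\<^sub>M (\<mu> \<Otimes>\<^sub>M \<nu>)))
    = (\<integral>\<^sup>+x1. \<integral>\<^sup>+x2. \<integral>\<^sup>+y1. \<integral>\<^sup>+y2. F ((x1, y1), (x2, y2)) \<partial>\<nu> \<partial>\<nu> \<partial>\<mu> \<partial>\<mu>)"
proof -
  interpret \<mu>: prob_space \<mu> using borel_probsD[OF \<mu>] by blast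
  interpret \<nu>: prob_space \<nu> using borel_probsD[OF \<nu>] by blast
  interpret P: pair_prob_space \<mu> \<nu> by standard
  note [measurable] = F
  have "(\<integral>\<^sup>+w. F w \<partial>((\<mu> \<Otimes>\<^sub>M \<nu>) \<Otimes>\<^sub>M (\<mu> \<Otimes>\<^sub>M \<nu>)))
      = (\<integral>\<^sup>+p. \<integral>\<^sup>+q. F (p, q) \<partial>(\<mu> \<Otimes>\<^sub>M \<nu>) \<partial>(\<mu> \<Otimes>\<^sub>M \<nu>))"
    by (rule P.nn_integral_fst[OF F, symmetric])
  also have "\<dots> = (\<integral>\<^sup>+x1. \<integral>\<^sup>+y1. \<integral>\<^sup>+q. F ((x1, y1), q) \<partial>(\<mu> \<Otimes>\<^sub>M \<nu>) \<partial>\<nu> \<partial>\<mu>)"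
    by (subst \<nu>.nn_integral_fst[symmetric]) measurable
  also have "\<dots> = (\<integral>\<^sup>+x1. \<integral>\<^sup>+y1. \<integral>\<^sup>+x2. \<integral>\<^sup>+y2. F ((x1, y1), (x2, y2)) \<partial>\<nu> \<partial>\<mu> \<partial>\<nu> \<partial>\<mu>)"
    by (intro nn_integral_cong \<nu>.nn_integral_fst[symmetric]) measurable
  also have "\<dots> = (\<integral>\<^sup>+x1. \<integral>\<^sup>+x2. \<integral>\<^sup>+y1. \<integral>\<^sup>+y2. F ((x1, y1), (x2, y2)) \<partial>\<nu> \<partial>\<nu> \<partial>\<mu> \<partial>\<mu>)"
    by (intro nn_integral_cong P.Fubini') measurable
  finally show ?thesis .
qed

lemma nn_integral_swap:
  assumes F: "F \<in> borel_measurable borel"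
  shows "(\<integral>\<^sup>+w. F (swap w) \<partial>((\<mu> \<Otimes>\<^sub>M \<nu>) \<Otimes>\<^sub>M (\<mu> \<Otimes>\<^sub>M \<nu>))) = (\<integral>\<^sup>+w. F w \<partial>((\<mu> \<Otimes>\<^sub>M \<nu>) \<Otimes>\<^sub>M (\<mu> \<Otimes>\<^sub>M \<nu>)))"
proof -
  note P = pair_borel_probs[OF \<mu> \<nu>]
  note s = borel_probsD(2)[OF pair_borel_probs[OF P P]]
  interpret \<nu>: prob_space \<nu> using borel_probsD[OF \<nu>] by blast
  interpret P: pair_prob_space \<nu> \<nu> by standard
  have F'[measurable]: "F \<in> borel_measurable ((\<mu> \<Otimes>\<^sub>M \<nu>) \<Otimes>\<^sub>M (\<mu> \<Otimes>\<^sub>M \<nu>))"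
    using F measurable_cong_sets[OF s refl] by blast
  have "(\<lambda>w. F (swap w)) \<in> borel_measurable borel" using F by measurable
  then have "(\<lambda>w. F (swap w)) \<in> borel_measurable ((\<mu> \<Otimes>\<^sub>M \<nu>) \<Otimes>\<^sub>M (\<mu> \<Otimes>\<^sub>M \<nu>))"
    using measurable_cong_sets[OF s refl] by blast
  then have "(\<integral>\<^sup>+w. F (swap w) \<partial>((\<mu> \<Otimes>\<^sub>M \<nu>) \<Otimes>\<^sub>M (\<mu> \<Otimes>\<^sub>M \<nu>)))
    = (\<integral>\<^sup>+x1. \<integral>\<^sup>+x2. \<integral>\<^sup>+y1. \<integral>\<^sup>+y2. F ((x1, y2), (x2, y1)) \<partial>\<nu> \<partial>\<nu> \<partial>\<mu> \<partial>\<mu>)"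
    by (simp add: nn_integral_pair_pair swap_def)
  also have "\<dots> = (\<integral>\<^sup>+x1. \<integral>\<^sup>+x2. \<integral>\<^sup>+y1. \<integral>\<^sup>+y2. F ((x1, y1), (x2, y2)) \<partial>\<nu> \<partial>\<nu> \<partial>\<mu> \<partial>\<mu>)"
    by (intro nn_integral_cong P.Fubini') measurable
  also have "\<dots> = (\<integral>\<^sup>+w. F w \<partial>((\<mu> \<Otimes>\<^sub>M \<nu>) \<Otimes>\<^sub>M (\<mu> \<Otimes>\<^sub>M \<nu>)))"
    by (rule nn_integral_pair_pair[symmetric]) measurable
  finally show ?thesis .
qed

lemma nn_integral_pair_density:
  assumes Z: "Z \<in> borel_measurable borel" and \<pi>: "\<pi> \<in> borel_probs" "density (\<mu> \<Otimes>\<^sub>M \<nu>) Z = \<pi>"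
    and F: "F \<in> borel_measurable borel"
  shows "(\<integral>\<^sup>+w. F w \<partial>(\<pi> \<Otimes>\<^sub>M \<pi>)) = (\<integral>\<^sup>+w. Z (fst w) * Z (snd w) * F w \<partial>((\<mu> \<Otimes>\<^sub>M \<nu>) \<Otimes>\<^sub>M (\<mu> \<Otimes>\<^sub>M \<nu>)))"
proof -
  note P = pair_borel_probs[OF \<mu> \<nu>]
  note PD = borel_probsD[OF P]
  note s = borel_probsD(2)[OF pair_borel_probs[OF P P]]
  note [measurable] = measurable_fst_borel measurable_snd_borel Z F
  have sf: "sigma_finite_measure (\<mu> \<Otimes>\<^sub>M \<nu>)" "sigma_finite_measure \<pi>"
    using PD borel_probsD[OF \<pi>(1)] by (simp_all add: prob_space_imp_sigma_finite)
  have Zm: "Z \<in> borel_measurable (\<mu> \<Otimes>\<^sub>M \<nu>)"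
    using Z measurable_cong_sets[OF PD(2) refl] by blast
  have "\<pi> \<Otimes>\<^sub>M \<pi> = density ((\<mu> \<Otimes>\<^sub>M \<nu>) \<Otimes>\<^sub>M (\<mu> \<Otimes>\<^sub>M \<nu>)) (\<lambda>(p, q). Z p * Z q)"
    using pair_measure_density[OF Zm Zm sf(1)] sf(2) by (simp add: \<pi>(2))
  also have "\<dots> = density ((\<mu> \<Otimes>\<^sub>M \<nu>) \<Otimes>\<^sub>M (\<mu> \<Otimes>\<^sub>M \<nu>)) (\<lambda>w. Z (fst w) * Z (snd w))"
    by (simp add: case_prod_beta')
  finally have d: "\<pi> \<Otimes>\<^sub>M \<pi> = density ((\<mu> \<Otimes>\<^sub>M \<nu>) \<Otimes>\<^sub>M (\<mu> \<Otimes>\<^sub>M \<nu>)) (\<lambda>w. Z (fst w) * Z (snd w))" .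
  show ?thesis unfolding d
  proof (rule nn_integral_density)
    show "(\<lambda>w. Z (fst w) * Z (snd w)) \<in> borel_measurable ((\<mu> \<Otimes>\<^sub>M \<nu>) \<Otimes>\<^sub>M (\<mu> \<Otimes>\<^sub>M \<nu>))"
      unfolding measurable_cong_sets[OF s refl] by measurable
    show "F \<in> borel_measurable ((\<mu> \<Otimes>\<^sub>M \<nu>) \<Otimes>\<^sub>M (\<mu> \<Otimes>\<^sub>M \<nu>))"
      unfolding measurable_cong_sets[OF s refl] by measurable
  qed
qed

text \<open>
  The identity for two points compares the density of \<open>\<pi> \<otimes> \<pi>\<close> at a point and at its image under \<open>swap\<close>,
  and the product of the marginals is invariant under \<open>swap\<close>.
\<close>

lemma cyclically_invariant_imp_swap_invariant:
  assumes cyc: "cyclically_invariant c \<epsilon> \<mu> \<nu> \<pi>" and c: "c \<in> borel_measurable borel"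
  shows "swap_invariant c \<epsilon> \<pi>"
  unfolding swap_invariant_def
proof (intro allI impI)
  fix F :: "('a \<times> 'b) \<times> ('a \<times> 'b) \<Rightarrow> ennreal" assume F[measurable]: "F \<in> borel_measurable borel"
  note P = pair_borel_probs[OF \<mu> \<nu>]
  have \<pi>: "\<pi> \<in> borel_probs" using cyc by (simp add: cyclically_invariant_def couplings_def)
  obtain Z where Z: "Z \<in> borel_measurable (\<mu> \<Otimes>\<^sub>M \<nu>)" "\<And>p. Z p > 0"
    and d: "density (\<mu> \<Otimes>\<^sub>M \<nu>) (\<lambda>p. ennreal (Z p)) = \<pi>"
    and prod: "\<forall>k\<ge>1. \<forall>(x :: nat \<Rightarrow> 'a) (y :: nat \<Rightarrow> 'b). y (k + 1) = y 1 \<longrightarrow>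
           (\<Prod>i=1..k. Z (x i, y i)) =
             exp (- (1 / \<epsilon>) * ((\<Sum>i=1..k. c (x i, y i)) - (\<Sum>i=1..k. c (x i, y (i + 1))))) *
             (\<Prod>i=1..k. Z (x i, y (i + 1)))"
    using cyc unfolding cyclically_invariant_def by blast
  have Z2: "Z (fst w) * Z (snd w) = exp (- excess c w / \<epsilon>) * (Z (fst (swap w)) * Z (snd (swap w)))" for w
    by (rule cyclically_invariant_two[OF prod])
  have Zm[measurable]: "Z \<in> borel_measurable borel"
    using Z(1) measurable_cong_sets[OF borel_probsD(2)[OF P] refl] by blast
  note [measurable] = measurable_excess[OF c] measurable_fst_borel measurable_snd_borel
  let ?PP = "(\<mu> \<Otimes>\<^sub>M \<nu>) \<Otimes>\<^sub>M (\<mu> \<Otimes>\<^sub>M \<nu>)"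
  let ?H = "\<lambda>w. Z (fst w) * Z (snd w)"
  have int: "(\<integral>\<^sup>+w. G w \<partial>(\<pi> \<Otimes>\<^sub>M \<pi>)) = (\<integral>\<^sup>+w. ennreal (?H w) * G w \<partial>?PP)"
    if [measurable]: "G \<in> borel_measurable borel" for G :: "('a \<times> 'b) \<times> ('a \<times> 'b) \<Rightarrow> ennreal"
    using nn_integral_pair_density[OF _ \<pi> d, of G] by (simp add: ennreal_mult less_imp_le[OF Z(2)])
  have "(\<integral>\<^sup>+w. F (swap w) * ennreal (exp (excess c w / \<epsilon>)) \<partial>(\<pi> \<Otimes>\<^sub>M \<pi>))
      = (\<integral>\<^sup>+w. ennreal (?H w) * (F (swap w) * ennreal (exp (excess c w / \<epsilon>))) \<partial>?PP)"
    by (rule int) measurable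
  also have "\<dots> = (\<integral>\<^sup>+w. ennreal (?H (swap w)) * (F w * ennreal (exp (- excess c w / \<epsilon>))) \<partial>?PP)"
    by (subst nn_integral_swap[symmetric]) (simp, simp)
  also have "\<dots> = (\<integral>\<^sup>+w. ennreal (?H w) * F w \<partial>?PP)"
  proof (rule nn_integral_cong)
    fix w
    have "ennreal (?H w) = ennreal (exp (- excess c w / \<epsilon>)) * ennreal (?H (swap w))"
      unfolding Z2[of w] by (intro ennreal_mult) (simp_all add: less_imp_le[OF Z(2)])
    then show "ennreal (?H (swap w)) * (F w * ennreal (exp (- excess c w / \<epsilon>))) = ennreal (?H w) * F w"
      by (simp add: mult_ac)
  qed
  also have "\<dots> = (\<integral>\<^sup>+w. F w \<partial>(\<pi> \<Otimes>\<^sub>M \<pi>))"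
    by (rule int[symmetric]) measurable
  finally show "(\<integral>\<^sup>+w. F w \<partial>(\<pi> \<Otimes>\<^sub>M \<pi>)) = (\<integral>\<^sup>+w. F (swap w) * ennreal (exp (excess c w / \<epsilon>)) \<partial>(\<pi> \<Otimes>\<^sub>M \<pi>))" ..
qed

end

section \<open>Swap invariance of weak limits\<close>

text \<open>
  The cutoff \<open>max 0 (1 - a / K)\<close> increases to 1 as \<open>K\<close> grows, so monotone convergence removes it.
\<close>

lemma swap_invariant_from_truncation:
  fixes \<pi> :: "('a::{metric_space,second_countable_topology} \<times> 'b::{metric_space,second_countable_topology}) measure"
  assumes \<pi>: "\<pi> \<in> borel_probs" and c: "continuous_on UNIV c"
    and a: "\<And>w. a w \<ge> 0" "continuous_on UNIV a"
    and trunc: "\<And>K F. K > 0 \<Longrightarrow> F \<in> borel_measurable borel \<Longrightarrow>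
      (\<integral>\<^sup>+w. F w * ennreal (max 0 (1 - a w / K) * exp (excess c w / (2 * \<epsilon>))) \<partial>(\<pi> \<Otimes>\<^sub>M \<pi>)) =
      (\<integral>\<^sup>+w. F (swap w) * ennreal (max 0 (1 - a w / K) * exp (excess c w / (2 * \<epsilon>))) \<partial>(\<pi> \<Otimes>\<^sub>M \<pi>))"
  shows "swap_invariant c \<epsilon> \<pi>"
  unfolding swap_invariant_def
proof (intro allI impI)
  fix F :: "('a \<times> 'b) \<times> ('a \<times> 'b) \<Rightarrow> ennreal" assume F[measurable]: "F \<in> borel_measurable borel"
  have s: "sets (\<pi> \<Otimes>\<^sub>M \<pi>) = sets borel"
    using borel_probsD(2)[OF pair_borel_probs[OF \<pi> \<pi>]] .
  have [measurable]: "a \<in> borel_measurable borel" "excess c \<in> borel_measurable borel"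
    using a(2) continuous_on_excess[OF c] by (auto intro: borel_measurable_continuous_onI)
  define \<eta> where "\<eta> k w = max 0 (1 - a w / real (Suc k))" for k w
  have [measurable]: "\<eta> k \<in> borel_measurable borel" for k
    unfolding \<eta>_def by measurable
  have \<eta>0: "\<eta> k w \<ge> 0" for k w by (simp add: \<eta>_def)
  have lim: "(\<lambda>k. \<integral>\<^sup>+w. G w * ennreal (\<eta> k w) \<partial>(\<pi> \<Otimes>\<^sub>M \<pi>)) \<longlonglongrightarrow> (\<integral>\<^sup>+w. G w \<partial>(\<pi> \<Otimes>\<^sub>M \<pi>))"
    if [measurable]: "G \<in> borel_measurable borel" for G
  proof (rule nn_integral_LIMSEQ)
    show "incseq (\<lambda>k w. G w * ennreal (\<eta> k w))"
      unfolding incseq_def le_fun_def \<eta>_def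
      by (intro allI impI mult_left_mono ennreal_leI max.mono diff_left_mono divide_left_mono)
        (auto simp: a)
    show "(\<lambda>w. G w * ennreal (\<eta> k w)) \<in> borel_measurable (\<pi> \<Otimes>\<^sub>M \<pi>)" for k
      unfolding measurable_cong_sets[OF s refl] by measurable
    fix w
    have "(\<lambda>k. a w * inverse (real (Suc k))) \<longlonglongrightarrow> a w * 0"
      by (intro tendsto_mult tendsto_const LIMSEQ_inverse_real_of_nat)
    then have "(\<lambda>k. max 0 (1 - a w * inverse (real (Suc k)))) \<longlonglongrightarrow> max 0 (1 - a w * 0)"
      by (intro tendsto_max tendsto_diff tendsto_const)
    then have "(\<lambda>k. ennreal (\<eta> k w)) \<longlonglongrightarrow> ennreal 1"
      unfolding \<eta>_def by (intro tendsto_ennrealI) (simp add: field_class.field_divide_inverse)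
    then have "(\<lambda>k. G w * ennreal (\<eta> k w)) \<longlonglongrightarrow> G w * 1"
      by (intro tendsto_mult_ennreal tendsto_const) auto
    then show "(\<lambda>k. G w * ennreal (\<eta> k w)) \<longlonglongrightarrow> G w" by simp
  qed
  let ?E = "\<lambda>s w. ennreal (exp (s * (excess c w / (2 * \<epsilon>))))"
  have EE: "?E (-1) w * ?E 1 w = 1" "?E 1 w * ?E 1 w = ennreal (exp (excess c w / \<epsilon>))" for w
    by (simp_all add: ennreal_mult[symmetric] exp_add[symmetric])
  have eq: "(\<integral>\<^sup>+w. F w * ennreal (\<eta> k w) \<partial>(\<pi> \<Otimes>\<^sub>M \<pi>))
      = (\<integral>\<^sup>+w. (F (swap w) * ennreal (exp (excess c w / \<epsilon>))) * ennreal (\<eta> k w) \<partial>(\<pi> \<Otimes>\<^sub>M \<pi>))" for k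
  proof -
    have m: "(\<lambda>w. F w * ?E (-1) w) \<in> borel_measurable borel" by measurable
    have "(\<integral>\<^sup>+w. F w * ennreal (\<eta> k w) \<partial>(\<pi> \<Otimes>\<^sub>M \<pi>))
        = (\<integral>\<^sup>+w. (F w * ?E (-1) w) * ennreal (\<eta> k w * exp (excess c w / (2 * \<epsilon>))) \<partial>(\<pi> \<Otimes>\<^sub>M \<pi>))"
    proof (rule nn_integral_cong)
      fix w
      have "(F w * ?E (-1) w) * ennreal (\<eta> k w * exp (excess c w / (2 * \<epsilon>)))
          = F w * ennreal (\<eta> k w) * (?E (-1) w * ?E 1 w)"
        using \<eta>0 by (simp add: ennreal_mult mult_ac)
      then show "F w * ennreal (\<eta> k w) = (F w * ?E (-1) w) * ennreal (\<eta> k w * exp (excess c w / (2 * \<epsilon>)))"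
        unfolding EE by simp
    qed
    also have "\<dots> = (\<integral>\<^sup>+w. (F (swap w) * ?E (-1) (swap w)) * ennreal (\<eta> k w * exp (excess c w / (2 * \<epsilon>))) \<partial>(\<pi> \<Otimes>\<^sub>M \<pi>))"
      unfolding \<eta>_def by (rule trunc[OF _ m]) simp
    also have "\<dots> = (\<integral>\<^sup>+w. (F (swap w) * ennreal (exp (excess c w / \<epsilon>))) * ennreal (\<eta> k w) \<partial>(\<pi> \<Otimes>\<^sub>M \<pi>))"
    proof (rule nn_integral_cong)
      fix w
      have "(F (swap w) * ?E (-1) (swap w)) * ennreal (\<eta> k w * exp (excess c w / (2 * \<epsilon>)))
          = F (swap w) * (?E 1 w * ?E 1 w) * ennreal (\<eta> k w)"
        using \<eta>0 by (simp add: ennreal_mult mult_ac)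
      then show "(F (swap w) * ?E (-1) (swap w)) * ennreal (\<eta> k w * exp (excess c w / (2 * \<epsilon>)))
          = (F (swap w) * ennreal (exp (excess c w / \<epsilon>))) * ennreal (\<eta> k w)"
        unfolding EE .
    qed
    finally show ?thesis .
  qed
  have m: "(\<lambda>w. F (swap w) * ennreal (exp (excess c w / \<epsilon>))) \<in> borel_measurable borel"
    by measurable
  show "(\<integral>\<^sup>+w. F w \<partial>(\<pi> \<Otimes>\<^sub>M \<pi>)) = (\<integral>\<^sup>+w. F (swap w) * ennreal (exp (excess c w / \<epsilon>)) \<partial>(\<pi> \<Otimes>\<^sub>M \<pi>))"
    by (rule LIMSEQ_unique[OF lim[OF F, unfolded eq] lim[OF m]])
qed

text \<open>
  A continuous cost need not be bounded on bounded sets, and where it is unbounded neither division by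
  \<open>\<epsilon>\<close> nor the exponential preserves uniform convergence; hence the bound on \<open>excess c\<close>.
\<close>

lemma uniform_limit_truncated_weight:
  fixes cn :: "nat \<Rightarrow> 'a::metric_space \<times> 'b::metric_space \<Rightarrow> real"
  assumes unif: "\<And>S. bounded S \<Longrightarrow> uniform_limit S cn c sequentially"
    and \<epsilon>: "\<epsilon>n \<longlonglongrightarrow> \<epsilon>" "\<epsilon> > 0"
    and S: "bounded (fst ` S)" "bounded (snd ` S)" "swap ` S \<subseteq> S" "\<And>w. w \<in> S \<Longrightarrow> \<bar>excess c w\<bar> \<le> K"
  shows "uniform_limit S (\<lambda>n w. exp (excess (cn n) w / (2 * \<epsilon>n n))) (\<lambda>w. exp (excess c w / (2 * \<epsilon>))) sequentially"
proof -
  define B where "B = fst ` S \<union> snd ` S"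
  have "uniform_limit B cn c sequentially"
    unfolding B_def using S by (intro unif) auto
  then have u: "uniform_limit S (\<lambda>n w. cn n (g w)) (\<lambda>w. c (g w)) sequentially" if "g \<in> S \<rightarrow> B" for g
    using that by (rule uniform_limit_compose')
  have "fst \<in> S \<rightarrow> B" "snd \<in> S \<rightarrow> B" "(\<lambda>w. fst (swap w)) \<in> S \<rightarrow> B" "(\<lambda>w. snd (swap w)) \<in> S \<rightarrow> B"
    using S(3) by (auto simp: B_def)
  then have ex: "uniform_limit S (\<lambda>n w. excess (cn n) w) (excess c) sequentially"
    unfolding excess_def[abs_def] by (intro uniform_limit_add uniform_limit_minus u)
  have e': "uniform_limit S (\<lambda>n w. 1 / (2 * \<epsilon>n n)) (\<lambda>w. 1 / (2 * \<epsilon>)) sequentially"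
  proof (rule uniform_limitI)
    fix d :: real assume "d > 0"
    have "(\<lambda>n. 1 / (2 * \<epsilon>n n)) \<longlonglongrightarrow> 1 / (2 * \<epsilon>)"
      using \<epsilon> by (intro tendsto_intros) auto
    from tendstoD[OF this \<open>d > 0\<close>]
    show "\<forall>\<^sub>F n in sequentially. \<forall>w\<in>S. dist (1 / (2 * \<epsilon>n n)) (1 / (2 * \<epsilon>)) < d"
      by eventually_elim auto
  qed
  have q: "uniform_limit S (\<lambda>n w. excess (cn n) w * (1 / (2 * \<epsilon>n n))) (\<lambda>w. excess c w * (1 / (2 * \<epsilon>))) sequentially"
  proof (rule uniform_lim_mult[OF ex e'])
    show "bounded (excess c ` S)" using S(4) by (auto intro!: boundedI[of _ K])
  qed (auto simp: image_constant_conv)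
  \<comment> \<open>The limit exponents are at most \<open>K / (2 \<epsilon>)\<close> in absolute value, the approximating ones eventually exceed this by at most 1.\<close>
  define L where "L = K / (2 * \<epsilon>) + 1"
  have "uniform_limit S (\<lambda>n w. exp (excess (cn n) w * (1 / (2 * \<epsilon>n n)))) (\<lambda>w. exp (excess c w * (1 / (2 * \<epsilon>)))) sequentially"
  proof (rule uniform_limit_compose_uniformly_continuous_on[OF q, where B = "{-L..L}"])
    show "uniformly_continuous_on {-L..L} (exp :: real \<Rightarrow> real)"
      by (intro compact_uniformly_continuous continuous_intros) auto
    show "\<forall>\<^sub>F n in sequentially. \<forall>w\<in>S. excess (cn n) w * (1 / (2 * \<epsilon>n n)) \<in> {-L..L}"
      using uniform_limitD[OF q zero_less_one]
    proof eventually_elim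
      case (elim n)
      show ?case
      proof
        fix w assume w: "w \<in> S"
        have "\<bar>excess c w * (1 / (2 * \<epsilon>))\<bar> \<le> K / (2 * \<epsilon>)"
          using S(4)[OF w] \<epsilon>(2) by (simp add: abs_mult divide_right_mono)
        then show "excess (cn n) w * (1 / (2 * \<epsilon>n n)) \<in> {-L..L}"
          using elim w by (auto simp: L_def dist_real_def abs_if split: if_splits)
      qed
    qed
  qed auto
  then show ?thesis by simp
qed

text \<open>
  With the cutoff, the weights along the sequence converge uniformly on the whole space, so exchanging
  them for the limit weight costs at most \<open>e/2\<close> on each side of the identity. The limit weight is
  continuous and bounded, and weak convergence applies. One inequality is enough, since it can also be
  applied to the function composed with \<open>swap\<close>.
\<close>

lemma swap_invariant_limit:
  fixes \<pi> :: "('a::{metric_space,second_countable_topology} \<times> 'b::{metric_space,second_countable_topology}) measure"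
  assumes \<pi>n: "\<And>n. \<pi>n n \<in> borel_probs" and \<pi>: "\<pi> \<in> borel_probs"
    and wc: "weak_conv_to (\<lambda>n. \<pi>n n \<Otimes>\<^sub>M \<pi>n n) (\<pi> \<Otimes>\<^sub>M \<pi>)"
    and inv: "\<And>n. swap_invariant (cn n) (\<epsilon>n n) (\<pi>n n)"
    and cn: "\<And>n. cn n \<in> borel_measurable borel"
    and unif: "\<And>S. bounded S \<Longrightarrow> uniform_limit S cn c sequentially"
    and \<epsilon>: "\<epsilon>n \<longlonglongrightarrow> \<epsilon>" "\<epsilon> > 0"
    and c: "continuous_on UNIV c"
  shows "swap_invariant c \<epsilon> \<pi>"
proof -
  obtain x0 :: 'a and y0 :: 'b where True by simp
  define R where "R w = dist (fst (fst w)) x0 + dist (fst (snd w)) x0 + dist (snd (fst w)) y0 + dist (snd (snd w)) y0"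
    for w :: "('a \<times> 'b) \<times> ('a \<times> 'b)"
  \<comment> \<open>Where \<open>a\<close> is bounded, so are the excess and both points; and \<open>a\<close> is invariant under \<open>swap\<close>.\<close>
  define a where "a w = \<bar>excess c w\<bar> + R w" for w
  have R0: "R w \<ge> 0" for w by (simp add: R_def)
  have a0: "a w \<ge> 0" for w by (simp add: a_def R0)
  have a_swap: "a (swap w) = a w" for w
    by (simp add: a_def R_def) (simp add: swap_def)
  have a_cont: "continuous_on UNIV a"
    unfolding a_def[abs_def] R_def by (intro continuous_intros continuous_on_excess[OF c])
  have PP: "N \<Otimes>\<^sub>M N \<in> borel_probs" if "N \<in> borel_probs" for N :: "('a \<times> 'b) measure"
    using that by (intro pair_borel_probs)
  show ?thesis
  proof (rule swap_invariant_from_truncation[OF \<pi> c a0 a_cont])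
    fix K :: real and F :: "('a \<times> 'b) \<times> ('a \<times> 'b) \<Rightarrow> ennreal"
    assume K: "K > 0" and F: "F \<in> borel_measurable borel"
    define \<eta> where "\<eta> w = max 0 (1 - a w / K)" for w
    define h where "h w = \<eta> w * exp (excess c w / (2 * \<epsilon>))" for w
    define hn where "hn n w = \<eta> w * exp (excess (cn n) w / (2 * \<epsilon>n n))" for n w
    define S where "S = {w. a w \<le> K}"
    have \<eta>: "0 \<le> \<eta> w" "\<eta> w \<le> 1" "w \<notin> S \<Longrightarrow> \<eta> w = 0" "\<eta> (swap w) = \<eta> w" for w
      using K a0[of w] by (auto simp: \<eta>_def S_def a_swap field_simps)
    have \<eta>_cont: "continuous_on UNIV \<eta>"
      unfolding \<eta>_def using K by (intro continuous_intros a_cont) auto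
    have h_cont: "continuous_on UNIV h"
      unfolding h_def using \<epsilon>(2) by (intro continuous_intros \<eta>_cont continuous_on_excess[OF c]) auto
    have h0: "0 \<le> h w" and hn0: "0 \<le> hn n w" for n w using \<eta> by (simp_all add: h_def hn_def)
    have S_ex: "\<bar>excess c w\<bar> \<le> K" and S_R: "R w \<le> K" if "w \<in> S" for w
      using that R0[of w] by (auto simp: S_def a_def)
    have h_bd: "h w \<le> exp (K / (2 * \<epsilon>))" for w
    proof (cases "w \<in> S")
      case True
      have "h w \<le> 1 * exp (K / (2 * \<epsilon>))"
        unfolding h_def using \<eta> S_ex[OF True] \<epsilon>(2) by (intro mult_mono) (auto simp: divide_right_mono)
      then show ?thesis by simp
    qed (simp add: h_def \<eta>)
    have [measurable]: "\<eta> \<in> borel_measurable borel" "h \<in> borel_measurable borel"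
      using \<eta>_cont h_cont by (auto intro: borel_measurable_continuous_onI)
    have hn_meas[measurable]: "hn n \<in> borel_measurable borel" for n
      unfolding hn_def using measurable_excess[OF cn[of n]] by measurable
    have unif_h: "\<forall>\<^sub>F n in sequentially. \<forall>w. \<bar>hn n w - h w\<bar> \<le> d" if d: "d > 0" for d
    proof -
      have "bounded (fst ` S)"
        unfolding bounded_def
      proof (intro exI[of _ "(x0, y0)"] exI[of _ K] ballI)
        fix p assume "p \<in> fst ` S"
        then obtain w where w: "w \<in> S" "p = fst w" by auto
        have "dist (x0, y0) p \<le> dist x0 (fst p) + dist y0 (snd p)"
          by (simp add: dist_prod_def sqrt_sum_squares_le_sum)
        also have "\<dots> \<le> R w" by (simp add: R_def w dist_commute)
        finally show "dist (x0, y0) p \<le> K" using S_R[OF w(1)] by simp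
      qed
      moreover have "bounded (snd ` S)"
        unfolding bounded_def
      proof (intro exI[of _ "(x0, y0)"] exI[of _ K] ballI)
        fix p assume "p \<in> snd ` S"
        then obtain w where w: "w \<in> S" "p = snd w" by auto
        have "dist (x0, y0) p \<le> dist x0 (fst p) + dist y0 (snd p)"
          by (simp add: dist_prod_def sqrt_sum_squares_le_sum)
        also have "\<dots> \<le> R w" by (simp add: R_def w dist_commute)
        finally show "dist (x0, y0) p \<le> K" using S_R[OF w(1)] by simp
      qed
      moreover have "swap ` S \<subseteq> S" by (auto simp: S_def a_swap)
      ultimately have "uniform_limit S (\<lambda>n w. exp (excess (cn n) w / (2 * \<epsilon>n n))) (\<lambda>w. exp (excess c w / (2 * \<epsilon>))) sequentially"
        using S_ex by (intro uniform_limit_truncated_weight[OF unif \<epsilon>])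
      from uniform_limitD[OF this d] show ?thesis
      proof eventually_elim
        case (elim n)
        show ?case
        proof
          fix w
          show "\<bar>hn n w - h w\<bar> \<le> d"
          proof (cases "w \<in> S")
            case True
            have "\<bar>hn n w - h w\<bar> = \<eta> w * \<bar>exp (excess (cn n) w / (2 * \<epsilon>n n)) - exp (excess c w / (2 * \<epsilon>))\<bar>"
              using \<eta>(1)[of w] unfolding hn_def h_def by (simp add: abs_mult flip: right_diff_distrib)
            also have "\<dots> \<le> 1 * d"
              using elim True \<eta> by (intro mult_mono) (auto simp: dist_real_def less_imp_le)
            finally show ?thesis by simp
          qed (use d in \<open>simp add: hn_def h_def \<eta>\<close>)
        qed
      qed
    qed
    have int: "integrable (N \<Otimes>\<^sub>M N) (\<lambda>w. f w * h w)"
      and nn_int: "(\<integral>\<^sup>+w. ennreal (f w * h w) \<partial>(N \<Otimes>\<^sub>M N)) = ennreal (\<integral>w. f w * h w \<partial>(N \<Otimes>\<^sub>M N))"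
      and int0: "0 \<le> (\<integral>w. f w * h w \<partial>(N \<Otimes>\<^sub>M N))"
      if N: "N \<in> borel_probs" and f: "f \<in> borel_measurable borel" "\<And>w. 0 \<le> f w" "\<And>w. f w \<le> 1" for f N
    proof -
      note NN = borel_probsD[OF PP[OF N]]
      interpret NN: prob_space "N \<Otimes>\<^sub>M N" by (rule NN)
      have "(\<lambda>w. f w * h w) \<in> borel_measurable (N \<Otimes>\<^sub>M N)"
        unfolding measurable_cong_sets[OF NN(2) refl] using f(1) by measurable
      moreover have "norm (f w * h w) \<le> 1 * exp (K / (2 * \<epsilon>))" for w
        unfolding norm_mult using f(2,3)[of w] h0[of w] h_bd[of w] by (intro mult_mono) auto
      ultimately show i: "integrable (N \<Otimes>\<^sub>M N) (\<lambda>w. f w * h w)"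
        by (intro NN.integrable_const_bound[of _ "1 * exp (K / (2 * \<epsilon>))"]) auto
      show "(\<integral>\<^sup>+w. ennreal (f w * h w) \<partial>(N \<Otimes>\<^sub>M N)) = ennreal (\<integral>w. f w * h w \<partial>(N \<Otimes>\<^sub>M N))"
        using f(2) h0 by (intro nn_integral_eq_integral i) auto
      show "0 \<le> (\<integral>w. f w * h w \<partial>(N \<Otimes>\<^sub>M N))" using f(2) h0 by simp
    qed
    have le: "(\<integral>w. f w * h w \<partial>(\<pi> \<Otimes>\<^sub>M \<pi>)) \<le> (\<integral>w. f (swap w) * h w \<partial>(\<pi> \<Otimes>\<^sub>M \<pi>))"
      if f: "continuous_on UNIV f" "\<And>w. 0 \<le> f w" "\<And>w. f w \<le> 1" for f
    proof (rule field_le_epsilon)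
      fix e :: real assume "e > 0"
      then have d: "e / 2 > 0" by simp
      have fs: "continuous_on UNIV (\<lambda>w. f (swap w))"
        by (rule continuous_on_compose2[OF f(1) continuous_on_swap]) simp
      have fm[measurable]: "f \<in> borel_measurable borel" and fsm[measurable]: "(\<lambda>w. f (swap w)) \<in> borel_measurable borel"
        using f(1) fs by (auto intro: borel_measurable_continuous_onI)
      have lim: "(\<lambda>n. \<integral>w. g w * h w \<partial>(\<pi>n n \<Otimes>\<^sub>M \<pi>n n)) \<longlonglongrightarrow> (\<integral>w. g w * h w \<partial>(\<pi> \<Otimes>\<^sub>M \<pi>))"
        if g: "continuous_on UNIV g" "\<And>w. 0 \<le> g w" "\<And>w. g w \<le> 1" for g
      proof -
        have "norm (g w * h w) \<le> 1 * exp (K / (2 * \<epsilon>))" for w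
          unfolding norm_mult using g(2,3)[of w] h0[of w] h_bd[of w] by (intro mult_mono) auto
        then have "bounded (range (\<lambda>w. g w * h w))" unfolding bounded_iff by blast
        moreover have "continuous_on UNIV (\<lambda>w. g w * h w)" by (intro continuous_intros g h_cont)
        ultimately show ?thesis using wc unfolding weak_conv_to_def by blast
      qed
      have "\<forall>\<^sub>F n in sequentially. (\<integral>w. f w * h w \<partial>(\<pi>n n \<Otimes>\<^sub>M \<pi>n n)) \<le> (\<integral>w. f (swap w) * h w \<partial>(\<pi>n n \<Otimes>\<^sub>M \<pi>n n)) + e"
        using unif_h[OF d]
      proof eventually_elim
        case (elim n)
        note NN = borel_probsD[OF PP[OF \<pi>n[of n]]]
        interpret NN: prob_space "\<pi>n n \<Otimes>\<^sub>M \<pi>n n" by (rule NN)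
        have mm: "g \<in> borel_measurable (\<pi>n n \<Otimes>\<^sub>M \<pi>n n)" if "g \<in> borel_measurable borel" for g :: "_ \<Rightarrow> ennreal"
          unfolding measurable_cong_sets[OF NN(2) refl] by (rule that)
        have up: "(\<integral>\<^sup>+w. ennreal (g w * u w) \<partial>(\<pi>n n \<Otimes>\<^sub>M \<pi>n n)) \<le> (\<integral>\<^sup>+w. ennreal (g w * v w) \<partial>(\<pi>n n \<Otimes>\<^sub>M \<pi>n n)) + ennreal (e / 2)"
          if [measurable]: "g \<in> borel_measurable borel" "v \<in> borel_measurable borel"
            and g: "\<And>w. 0 \<le> g w" "\<And>w. g w \<le> 1" and uv: "\<And>w. 0 \<le> v w" "\<And>w. u w \<le> v w + e / 2" for g u v
        proof -
          have "(\<integral>\<^sup>+w. ennreal (g w * u w) \<partial>(\<pi>n n \<Otimes>\<^sub>M \<pi>n n)) \<le> (\<integral>\<^sup>+w. ennreal (g w * v w) + ennreal (e / 2) \<partial>(\<pi>n n \<Otimes>\<^sub>M \<pi>n n))"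
          proof (rule nn_integral_mono)
            fix w
            have "g w * u w \<le> g w * (v w + e / 2)" using g uv by (intro mult_left_mono)
            also have "\<dots> \<le> g w * v w + 1 * (e / 2)"
              unfolding distrib_left using g d by (intro add_left_mono mult_right_mono) auto
            finally have "ennreal (g w * u w) \<le> ennreal (g w * v w + e / 2)" by (intro ennreal_leI) simp
            also have "\<dots> = ennreal (g w * v w) + ennreal (e / 2)"
              using g uv d by (intro ennreal_plus) auto
            finally show "ennreal (g w * u w) \<le> ennreal (g w * v w) + ennreal (e / 2)" .
          qed
          also have "\<dots> = (\<integral>\<^sup>+w. ennreal (g w * v w) \<partial>(\<pi>n n \<Otimes>\<^sub>M \<pi>n n)) + ennreal (e / 2)"
            by (subst nn_integral_add) (auto intro!: mm simp: NN.emeasure_space_1)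
          finally show ?thesis .
        qed
        have sw: "(\<integral>\<^sup>+w. ennreal (f w * hn n w) \<partial>(\<pi>n n \<Otimes>\<^sub>M \<pi>n n)) = (\<integral>\<^sup>+w. ennreal (f (swap w) * hn n w) \<partial>(\<pi>n n \<Otimes>\<^sub>M \<pi>n n))"
        proof -
          have "(\<integral>\<^sup>+w. ennreal (f w * hn n w) \<partial>(\<pi>n n \<Otimes>\<^sub>M \<pi>n n))
              = (\<integral>\<^sup>+w. ennreal (f (swap w) * hn n (swap w)) * ennreal (exp (excess (cn n) w / \<epsilon>n n)) \<partial>(\<pi>n n \<Otimes>\<^sub>M \<pi>n n))"
            by (rule swap_invariantD[OF inv]) measurable
          also have "\<dots> = (\<integral>\<^sup>+w. ennreal (f (swap w) * hn n w) \<partial>(\<pi>n n \<Otimes>\<^sub>M \<pi>n n))"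
          proof (rule nn_integral_cong)
            fix w
            have "hn n (swap w) * exp (excess (cn n) w / \<epsilon>n n) = hn n w"
              by (simp add: hn_def \<eta> mult.assoc flip: exp_add)
            moreover have "ennreal (f (swap w) * hn n (swap w)) * ennreal (exp (excess (cn n) w / \<epsilon>n n))
                = ennreal (f (swap w) * (hn n (swap w) * exp (excess (cn n) w / \<epsilon>n n)))"
              using f(2) hn0 by (subst ennreal_mult[symmetric]) (simp_all add: mult.assoc)
            ultimately show "ennreal (f (swap w) * hn n (swap w)) * ennreal (exp (excess (cn n) w / \<epsilon>n n)) = ennreal (f (swap w) * hn n w)"
              by simp
          qed
          finally show ?thesis .
        qed
        \<comment> \<open>One exchange of weights before the swap and one after it add up to \<open>e\<close>.\<close>
        have c1: "h w \<le> hn n w + e / 2" and c2: "hn n w \<le> h w + e / 2" for w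
          using elim[rule_format, of w] by linarith+
        have "ennreal (\<integral>w. f w * h w \<partial>(\<pi>n n \<Otimes>\<^sub>M \<pi>n n)) = (\<integral>\<^sup>+w. ennreal (f w * h w) \<partial>(\<pi>n n \<Otimes>\<^sub>M \<pi>n n))"
          by (rule nn_int[OF \<pi>n fm f(2,3), symmetric])
        also have "\<dots> \<le> (\<integral>\<^sup>+w. ennreal (f w * hn n w) \<partial>(\<pi>n n \<Otimes>\<^sub>M \<pi>n n)) + ennreal (e / 2)"
          by (rule up[OF fm hn_meas f(2,3) hn0 c1])
        also have "\<dots> \<le> ((\<integral>\<^sup>+w. ennreal (f (swap w) * h w) \<partial>(\<pi>n n \<Otimes>\<^sub>M \<pi>n n)) + ennreal (e / 2)) + ennreal (e / 2)"
          unfolding sw by (intro add_right_mono up[OF fsm _ f(2,3) h0 c2]) measurable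
        also have "\<dots> = ennreal ((\<integral>w. f (swap w) * h w \<partial>(\<pi>n n \<Otimes>\<^sub>M \<pi>n n)) + e)"
          unfolding nn_int[OF \<pi>n fsm f(2,3)] using int0[OF \<pi>n fsm f(2,3)] d
          by (simp flip: ennreal_plus)
        finally show ?case
          using int0[OF \<pi>n fsm f(2,3)] d by (subst (asm) ennreal_le_iff) auto
      qed
      then show "(\<integral>w. f w * h w \<partial>(\<pi> \<Otimes>\<^sub>M \<pi>)) \<le> (\<integral>w. f (swap w) * h w \<partial>(\<pi> \<Otimes>\<^sub>M \<pi>)) + e"
        by (intro tendsto_le[OF _ tendsto_add[OF lim[OF fs f(2,3)] tendsto_const] lim[OF f]]) auto
    qed
    note \<pi>\<pi> = borel_probsD[OF PP[OF \<pi>]]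
    have m\<pi>: "g \<in> borel_measurable (\<pi> \<Otimes>\<^sub>M \<pi>)" if "g \<in> borel_measurable borel" for g :: "_ \<Rightarrow> 'z::topological_space"
      unfolding measurable_cong_sets[OF \<pi>\<pi>(2) refl] by (rule that)
    define \<rho> where "\<rho> = density (\<pi> \<Otimes>\<^sub>M \<pi>) (\<lambda>w. ennreal (h w))"
    have \<rho>_sets: "sets \<rho> = sets borel" by (simp add: \<rho>_def \<pi>\<pi>)
    have \<rho>_m: "g \<in> borel_measurable \<rho>" if "g \<in> borel_measurable borel" for g :: "_ \<Rightarrow> 'z::topological_space"
      unfolding measurable_cong_sets[OF \<rho>_sets refl] by (rule that)
    have \<rho>_fin: "finite_measure \<rho>"
    proof
      have "emeasure \<rho> (space \<rho>) = (\<integral>\<^sup>+w. ennreal (1 * h w) \<partial>(\<pi> \<Otimes>\<^sub>M \<pi>))"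
        unfolding \<rho>_def by (subst emeasure_density) (auto intro!: m\<pi> nn_integral_cong simp: \<pi>\<pi>)
      also have "\<dots> < \<infinity>" by (subst nn_int[OF \<pi>]) auto
      finally show "emeasure \<rho> (space \<rho>) \<noteq> \<infinity>" by simp
    qed
    have "\<rho> = distr \<rho> borel swap"
    proof (rule finite_measure_eqI_continuous[OF \<rho>_fin \<rho>_sets])
      show "finite_measure (distr \<rho> borel swap)"
        by (intro finite_measure.finite_measure_distr \<rho>_fin \<rho>_m measurable_swap)
      fix f :: "('a \<times> 'b) \<times> ('a \<times> 'b) \<Rightarrow> real" assume f: "continuous_on UNIV f" "\<And>w. 0 \<le> f w" "\<And>w. f w \<le> 1"
      have fs: "continuous_on UNIV (\<lambda>w. f (swap w))"
        by (rule continuous_on_compose2[OF f(1) continuous_on_swap]) simp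
      have fm[measurable]: "f \<in> borel_measurable borel" and fsm[measurable]: "(\<lambda>w. f (swap w)) \<in> borel_measurable borel"
        using f(1) fs by (auto intro: borel_measurable_continuous_onI)
      have d: "integral\<^sup>L \<rho> g = (\<integral>w. g w * h w \<partial>(\<pi> \<Otimes>\<^sub>M \<pi>))" if "g \<in> borel_measurable borel" for g :: "_ \<Rightarrow> real"
        unfolding \<rho>_def using h0 that by (subst integral_density) (auto intro!: m\<pi> simp: mult.commute)
      have "(\<integral>w. f w * h w \<partial>(\<pi> \<Otimes>\<^sub>M \<pi>)) = (\<integral>w. f (swap w) * h w \<partial>(\<pi> \<Otimes>\<^sub>M \<pi>))"
        using le[OF f] le[OF fs f(2,3)] by simp
      moreover have "integral\<^sup>L (distr \<rho> borel swap) f = integral\<^sup>L \<rho> (\<lambda>w. f (swap w))"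
        by (intro integral_distr \<rho>_m) auto
      ultimately show "integral\<^sup>L \<rho> f = integral\<^sup>L (distr \<rho> borel swap) f"
        using d[OF fm] d[OF fsm] by simp
    qed simp
    then have "(\<integral>\<^sup>+w. F w \<partial>\<rho>) = (\<integral>\<^sup>+w. F w \<partial>(distr \<rho> borel swap))" by simp
    also have "\<dots> = (\<integral>\<^sup>+w. F (swap w) \<partial>\<rho>)"
      using F by (intro nn_integral_distr \<rho>_m) auto
    finally have "(\<integral>\<^sup>+w. F w \<partial>\<rho>) = (\<integral>\<^sup>+w. F (swap w) \<partial>\<rho>)" .
    moreover have "(\<integral>\<^sup>+w. G w \<partial>\<rho>) = (\<integral>\<^sup>+w. G w * ennreal (h w) \<partial>(\<pi> \<Otimes>\<^sub>M \<pi>))"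
      if "G \<in> borel_measurable borel" for G
      unfolding \<rho>_def using that by (subst nn_integral_density) (auto intro!: m\<pi> simp: mult.commute)
    moreover have "(\<lambda>w. F (swap w)) \<in> borel_measurable borel" using F by measurable
    ultimately show "(\<integral>\<^sup>+w. F w * ennreal (max 0 (1 - a w / K) * exp (excess c w / (2 * \<epsilon>))) \<partial>(\<pi> \<Otimes>\<^sub>M \<pi>)) =
      (\<integral>\<^sup>+w. F (swap w) * ennreal (max 0 (1 - a w / K) * exp (excess c w / (2 * \<epsilon>))) \<partial>(\<pi> \<Otimes>\<^sub>M \<pi>))"
      using F by (simp add: h_def \<eta>_def)
  qed
qed

section \<open>Cyclical invariance from swap invariance\<close>

text \<open>
  In a product over a cycle the factors depending on one coordinate only are merely permuted.
\<close>

lemma cyclic_product_if_factorized: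
  fixes Z :: "'a \<times> 'b \<Rightarrow> real"
  assumes Z: "\<And>x y. Z (x, y) = a x * b y * exp (- c (x, y) / \<epsilon>)"
    and y: "y (k + 1) = y 1" and k: "k \<ge> (1::nat)"
  shows "(\<Prod>i=1..k. Z (x i, y i)) =
     exp (- (1 / \<epsilon>) * ((\<Sum>i=1..k. c (x i, y i)) - (\<Sum>i=1..k. c (x i, y (i + 1))))) * (\<Prod>i=1..k. Z (x i, y (i + 1)))"
proof -
  have prod: "(\<Prod>i=1..k. Z (x i, u i)) =
      (\<Prod>i=1..k. a (x i)) * (\<Prod>i=1..k. b (u i)) * exp (- (\<Sum>i=1..k. c (x i, u i)) / \<epsilon>)" for u
    by (simp add: Z prod.distrib sum_divide_distrib sum_negf[symmetric] flip: exp_sum)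
  have "(\<Prod>i=1..k. b (y (i + 1))) = (\<Prod>i=1 + 1..k + 1. b (y i))"
    by (rule prod.shift_bounds_cl_nat_ivl[symmetric])
  also have "\<dots> = (\<Prod>i=1 + 1..k. b (y i)) * b (y (k + 1))"
    using k by (cases "k = 1") (simp_all add: prod.nat_ivl_Suc')
  also have "\<dots> = (\<Prod>i=1..k. b (y i))"
    using k y prod.atLeast_Suc_atMost[of 1 k "\<lambda>i. b (y i)"] by simp
  finally have b: "(\<Prod>i=1..k. b (y (i + 1))) = (\<Prod>i=1..k. b (y i))" .
  have "exp (- (1 / \<epsilon>) * ((\<Sum>i=1..k. c (x i, y i)) - (\<Sum>i=1..k. c (x i, y (i + 1)))))
      * exp (- (\<Sum>i=1..k. c (x i, y (i + 1))) / \<epsilon>) = exp (- (\<Sum>i=1..k. c (x i, y i)) / \<epsilon>)"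
    by (simp add: diff_divide_distrib flip: exp_add)
  then show ?thesis
    unfolding prod[of y] prod[of "\<lambda>i. y (i + 1)"] b by (simp add: mult_ac)
qed

context
  fixes \<mu> :: "'a::second_countable_topology measure" and \<nu> :: "'b::second_countable_topology measure"
    and \<pi> :: "('a \<times> 'b) measure"
  assumes \<mu>: "\<mu> \<in> borel_probs" and \<nu>: "\<nu> \<in> borel_probs" and \<pi>: "\<pi> \<in> couplings \<mu> \<nu>"
begin

text \<open>
  Under \<open>\<pi> \<otimes> \<pi>\<close> the coordinates \<open>x\<^sub>1\<close> and \<open>y\<^sub>2\<close> are independent.
\<close>

lemma nn_integral_cross_marginal:
  assumes G: "G \<in> borel_measurable borel"
  shows "(\<integral>\<^sup>+w. G (fst (swap w)) \<partial>(\<pi> \<Otimes>\<^sub>M \<pi>)) = (\<integral>\<^sup>+p. G p \<partial>(\<mu> \<Otimes>\<^sub>M \<nu>))"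
proof -
  note pi = couplingsD[OF \<pi>]
  note s = borel_probsD(2)[OF pair_borel_probs[OF pi(1) pi(1)]]
  have m: "fst \<in> borel_measurable \<pi>" "snd \<in> borel_measurable \<pi>"
    unfolding measurable_cong_sets[OF borel_probsD(2)[OF pi(1)] refl]
    by (rule measurable_fst_borel measurable_snd_borel)+
  have "sigma_finite_measure \<nu>"
    using borel_probsD[OF \<nu>] by (simp add: prob_space_imp_sigma_finite)
  then have "\<mu> \<Otimes>\<^sub>M \<nu> = distr (\<pi> \<Otimes>\<^sub>M \<pi>) (borel \<Otimes>\<^sub>M borel) (\<lambda>(p, q). (fst p, snd q))"
    using pair_measure_distr[OF m] by (simp add: pi)
  also have "\<dots> = distr (\<pi> \<Otimes>\<^sub>M \<pi>) borel (\<lambda>w. fst (swap w))"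
    unfolding borel_prod by (rule distr_cong) (auto simp: swap_def)
  finally have d: "\<mu> \<Otimes>\<^sub>M \<nu> = distr (\<pi> \<Otimes>\<^sub>M \<pi>) borel (\<lambda>w. fst (swap w))" .
  note [measurable] = measurable_fst_borel
  have "(\<lambda>w. fst (swap w)) \<in> borel_measurable (\<pi> \<Otimes>\<^sub>M \<pi>)"
    unfolding measurable_cong_sets[OF s refl] by measurable
  then show ?thesis unfolding d using G by (subst nn_integral_distr) auto
qed

lemma nn_integral_first_marginal:
  assumes G: "G \<in> borel_measurable borel"
  shows "(\<integral>\<^sup>+w. G (fst w) \<partial>(\<pi> \<Otimes>\<^sub>M \<pi>)) = (\<integral>\<^sup>+p. G p \<partial>\<pi>)"
proof -
  note pi = couplingsD[OF \<pi>]
  interpret prob_space \<pi> using borel_probsD[OF pi(1)] by blast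
  have Gm: "G \<in> borel_measurable \<pi>"
    using G measurable_cong_sets[OF borel_probsD(2)[OF pi(1)] refl] by blast
  have "(\<integral>\<^sup>+p. G p \<partial>\<pi>) = (\<integral>\<^sup>+p. G p \<partial>distr (\<pi> \<Otimes>\<^sub>M \<pi>) \<pi> fst)"
    by (simp add: distr_pair_fst)
  also have "\<dots> = (\<integral>\<^sup>+w. G (fst w) \<partial>(\<pi> \<Otimes>\<^sub>M \<pi>))"
    using Gm by (intro nn_integral_distr) auto
  finally show ?thesis ..
qed

text \<open>
  The weight in the definition of swap invariance is positive.
\<close>

lemma swap_invariant_null_iff:
  assumes inv: "swap_invariant c \<epsilon> \<pi>" and c: "c \<in> borel_measurable borel"
    and F: "F \<in> borel_measurable borel"
  shows "(\<integral>\<^sup>+w. F w \<partial>(\<pi> \<Otimes>\<^sub>M \<pi>)) = 0 \<longleftrightarrow> (\<integral>\<^sup>+w. F (swap w) \<partial>(\<pi> \<Otimes>\<^sub>M \<pi>)) = 0"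
proof -
  note pi = couplingsD[OF \<pi>]
  note s = borel_probsD(2)[OF pair_borel_probs[OF pi(1) pi(1)]]
  note [measurable] = F measurable_excess[OF c]
  have m: "(\<lambda>w. F (swap w)) \<in> borel_measurable (\<pi> \<Otimes>\<^sub>M \<pi>)"
      "(\<lambda>w. F (swap w) * ennreal (exp (excess c w / \<epsilon>))) \<in> borel_measurable (\<pi> \<Otimes>\<^sub>M \<pi>)"
    unfolding measurable_cong_sets[OF s refl] by measurable
  show ?thesis
    unfolding swap_invariantD[OF inv F] nn_integral_0_iff_AE[OF m(1)] nn_integral_0_iff_AE[OF m(2)]
    by (simp add: ennreal_zero_less_mult_iff not_le)
qed

text \<open>
  A set of pairs is tested at \<open>(x\<^sub>1, y\<^sub>1)\<close>, which has law \<open>\<pi>\<close>, and after swapping at \<open>(x\<^sub>1, y\<^sub>2)\<close>, which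
  has law \<open>\<mu> \<otimes> \<nu>\<close>.
\<close>

lemma swap_invariant_imp_equivalent:
  assumes inv: "swap_invariant c \<epsilon> \<pi>" and c: "c \<in> borel_measurable borel"
  shows "absolutely_continuous (\<mu> \<Otimes>\<^sub>M \<nu>) \<pi>" "absolutely_continuous \<pi> (\<mu> \<Otimes>\<^sub>M \<nu>)"
proof -
  note pi = couplingsD[OF \<pi>]
  note sets = borel_probsD(2)[OF pair_borel_probs[OF \<mu> \<nu>]] borel_probsD(2)[OF pi(1)]
  note [measurable] = measurable_fst_borel
  have "N \<in> null_sets (\<mu> \<Otimes>\<^sub>M \<nu>) \<longleftrightarrow> N \<in> null_sets \<pi>" for N
  proof (cases "N \<in> sets borel")
    case True
    note [measurable] = True
    let ?G = "indicator N :: _ \<Rightarrow> ennreal"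
    have G: "?G \<in> borel_measurable borel" by measurable
    have "emeasure \<pi> N = 0 \<longleftrightarrow> (\<integral>\<^sup>+w. ?G (fst w) \<partial>(\<pi> \<Otimes>\<^sub>M \<pi>)) = 0"
      unfolding nn_integral_first_marginal[OF G] using True sets by simp
    also have "\<dots> \<longleftrightarrow> (\<integral>\<^sup>+w. ?G (fst (swap w)) \<partial>(\<pi> \<Otimes>\<^sub>M \<pi>)) = 0"
      by (rule swap_invariant_null_iff[OF inv c]) measurable
    also have "\<dots> \<longleftrightarrow> emeasure (\<mu> \<Otimes>\<^sub>M \<nu>) N = 0"
      unfolding nn_integral_cross_marginal[OF G] using True sets by simp
    finally show ?thesis using True sets by (simp add: null_sets_def)
  qed (use sets in \<open>auto simp: null_sets_def\<close>)
  then show "absolutely_continuous (\<mu> \<Otimes>\<^sub>M \<nu>) \<pi>" "absolutely_continuous \<pi> (\<mu> \<Otimes>\<^sub>M \<nu>)"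
    by (auto simp: absolutely_continuous_def)
qed

text \<open>
  Both sides are densities of \<open>\<pi> \<otimes> \<pi>\<close> with respect to the square of \<open>\<mu> \<otimes> \<nu>\<close>, the right one by swap
  invariance.
\<close>

lemma swap_invariant_density_identity:
  assumes inv: "swap_invariant c \<epsilon> \<pi>" and c: "c \<in> borel_measurable borel"
    and f: "f \<in> borel_measurable borel" "density (\<mu> \<Otimes>\<^sub>M \<nu>) f = \<pi>"
  shows "AE w in (\<mu> \<Otimes>\<^sub>M \<nu>) \<Otimes>\<^sub>M (\<mu> \<Otimes>\<^sub>M \<nu>).
    f (fst w) * f (snd w) = f (fst (swap w)) * f (snd (swap w)) * ennreal (exp (- excess c w / \<epsilon>))"
proof -
  let ?PP = "(\<mu> \<Otimes>\<^sub>M \<nu>) \<Otimes>\<^sub>M (\<mu> \<Otimes>\<^sub>M \<nu>)"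
  note PP = borel_probsD[OF pair_borel_probs[OF pair_borel_probs[OF \<mu> \<nu>] pair_borel_probs[OF \<mu> \<nu>]]]
  interpret PP: prob_space ?PP by (rule PP)
  note [measurable] = f(1) measurable_excess[OF c] measurable_fst_borel measurable_snd_borel
  let ?l = "\<lambda>w. f (fst w) * f (snd w)"
  let ?r = "\<lambda>w. f (fst (swap w)) * f (snd (swap w)) * ennreal (exp (- excess c w / \<epsilon>))"
  have m: "?l \<in> borel_measurable ?PP" "?r \<in> borel_measurable ?PP"
    unfolding measurable_cong_sets[OF PP(2) refl] by measurable
  note int = nn_integral_pair_density[OF \<mu> \<nu> f(1) couplingsD(1)[OF \<pi>] f(2)]
  have "density ?PP ?l = density ?PP ?r"
  proof (rule measure_eqI)
    fix A assume "A \<in> sets (density ?PP ?l)"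
    then have A': "A \<in> sets ?PP" and A[measurable]: "A \<in> sets borel" using PP(2) by auto
    let ?I = "indicator A :: _ \<Rightarrow> ennreal"
    have "emeasure (density ?PP ?l) A = (\<integral>\<^sup>+w. ?I w \<partial>(\<pi> \<Otimes>\<^sub>M \<pi>))"
      using m A' by (subst int) (auto simp: emeasure_density)
    also have "\<dots> = (\<integral>\<^sup>+w. ?I (swap w) * ennreal (exp (excess c w / \<epsilon>)) \<partial>(\<pi> \<Otimes>\<^sub>M \<pi>))"
      by (rule swap_invariantD[OF inv]) measurable
    also have "\<dots> = (\<integral>\<^sup>+w. ?l w * (?I (swap w) * ennreal (exp (excess c w / \<epsilon>))) \<partial>?PP)"
      by (rule int) measurable
    also have "\<dots> = (\<integral>\<^sup>+w. ?l (swap w) * (?I w * ennreal (exp (- excess c w / \<epsilon>))) \<partial>?PP)"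
      by (subst nn_integral_swap[OF \<mu> \<nu>, symmetric]) (simp, simp)
    also have "\<dots> = (\<integral>\<^sup>+w. ?r w * ?I w \<partial>?PP)"
      by (intro nn_integral_cong) (simp add: mult_ac)
    also have "\<dots> = emeasure (density ?PP ?r) A"
      using m A' by (simp add: emeasure_density)
    finally show "emeasure (density ?PP ?l) A = emeasure (density ?PP ?r) A" .
  qed simp
  then show ?thesis
    unfolding PP.density_unique_iff[OF m] .
qed

text \<open>
  By Fubini there is a point \<open>p\<close> such that the identity for two points holds for \<open>p\<close> and almost every
  \<open>q\<close>. Solving it for the density at \<open>q\<close> expresses that density through its sections at \<open>p\<close>;
  replacing the values 0 and \<open>\<infinity>\<close> of the sections by 1 gives the positive version.
\<close>

lemma swap_invariant_imp_cyclically_invariant: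
  assumes inv: "swap_invariant c \<epsilon> \<pi>" and c: "c \<in> borel_measurable borel"
  shows "cyclically_invariant c \<epsilon> \<mu> \<nu> \<pi>"
proof -
  let ?P = "\<mu> \<Otimes>\<^sub>M \<nu>"
  note pi = couplingsD[OF \<pi>]
  note PD = borel_probsD[OF pair_borel_probs[OF \<mu> \<nu>]] and pD = borel_probsD[OF pi(1)]
  note ac = swap_invariant_imp_equivalent[OF inv c]
  interpret P: prob_space ?P by (rule PD)
  interpret pp: prob_space \<pi> by (rule pD)
  interpret PP: pair_prob_space ?P ?P by standard
  obtain f where fP: "f \<in> borel_measurable ?P" and f: "density ?P f = \<pi>"
    using P.Radon_Nikodym[OF ac(1)] pD(2) PD(2) by auto
  have fb[measurable]: "f \<in> borel_measurable borel"
    using fP measurable_cong_sets[OF PD(2) refl] by blast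
  have fpos: "AE p in ?P. 0 < f p"
  proof -
    have N: "{p. f p = 0} \<in> sets borel" by measurable
    have "emeasure \<pi> {p. f p = 0} = (\<integral>\<^sup>+p. f p * indicator {p. f p = 0} p \<partial>?P)"
      using N PD(2) fP by (subst f[symmetric]) (simp add: emeasure_density)
    also have "\<dots> = (\<integral>\<^sup>+p. 0 \<partial>?P)" by (intro nn_integral_cong) (auto simp: indicator_def)
    finally have "{p. f p = 0} \<in> null_sets \<pi>" using N pD(2) by (simp add: null_sets_def)
    then have "{p. f p = 0} \<in> null_sets ?P" using ac(2) by (auto simp: absolutely_continuous_def)
    then have "AE p in ?P. p \<notin> {p. f p = 0}" by (rule AE_not_in)
    then show ?thesis by eventually_elim (simp add: zero_less_iff_neq_zero)
  qed
  have "(\<integral>\<^sup>+p. f p \<partial>?P) = emeasure \<pi> (space ?P)"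
    using fP by (subst f[symmetric]) (simp add: emeasure_density cong: nn_integral_cong)
  then have "(\<integral>\<^sup>+p. f p \<partial>?P) \<noteq> \<infinity>" using pD PD pp.emeasure_space_1 by simp
  then have ffin: "AE p in ?P. f p \<noteq> \<infinity>" by (rule nn_integral_PInf_AE[OF fP])
  have "AE p in ?P. AE q in ?P. f p * f q =
      f (fst p, snd q) * f (fst q, snd p) * ennreal (exp (- excess c (p, q) / \<epsilon>))"
    using PP.AE_pair[OF swap_invariant_density_identity[OF inv c fb f]] by (simp add: swap_def)
  with fpos ffin have "AE p in ?P. 0 < f p \<and> f p \<noteq> \<infinity> \<and> (AE q in ?P. f p * f q =
      f (fst p, snd q) * f (fst q, snd p) * ennreal (exp (- excess c (p, q) / \<epsilon>)))"
    by eventually_elim auto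
  then obtain p where p: "0 < f p" "f p \<noteq> \<infinity>" and
    q: "AE q in ?P. f p * f q = f (fst p, snd q) * f (fst q, snd p) * ennreal (exp (- excess c (p, q) / \<epsilon>))"
    using P.ae_filter_bot[THEN eventually_happens'] by (metis (mono_tags, lifting))
  \<comment> \<open>The default value 1 keeps the factors positive and finite at the exceptional points.\<close>
  define pos where "pos t = (if 0 < t \<and> t \<noteq> \<infinity> then enn2real t else 1)" for t
  have pos: "0 < pos t" for t by (auto simp: pos_def enn2real_positive_iff less_top)
  have pos_eq: "ennreal (pos t) = t" if "0 < t" "t \<noteq> \<infinity>" for t
    using that by (simp add: pos_def less_top)
  have [measurable]: "pos \<in> borel_measurable borel" unfolding pos_def by measurable
  define Z where "Z q = pos (f (fst q, snd p)) * pos (f (fst p, snd q)) * exp (- excess c (p, q) / \<epsilon>) / pos (f p)" for q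
  define a where "a x = pos (f (x, snd p)) * exp ((c (x, snd p) - c p) / \<epsilon>) / pos (f p)" for x
  define b where "b y = pos (f (fst p, y)) * exp (c (fst p, y) / \<epsilon>)" for y
  have Zab: "Z (x, y) = a x * b y * exp (- c (x, y) / \<epsilon>)" for x y
  proof -
    have "exp (- excess c (p, (x, y)) / \<epsilon>) = exp ((c (x, snd p) - c p) / \<epsilon>) * exp (c (fst p, y) / \<epsilon>) * exp (- c (x, y) / \<epsilon>)"
      by (simp add: excess_def swap_def diff_divide_distrib add_divide_distrib flip: exp_add)
    then show ?thesis by (simp add: Z_def a_def b_def)
  qed
  have Zpos: "0 < Z q" for q unfolding Z_def using pos by simp
  have Zm: "Z \<in> borel_measurable borel"
  proof -
    note [measurable] = measurable_fst_borel measurable_snd_borel measurable_excess[OF c]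
    show ?thesis unfolding Z_def by measurable
  qed
  then have ZP: "Z \<in> borel_measurable ?P"
    using measurable_cong_sets[OF PD(2) refl] by blast
  have "AE q in ?P. f q = ennreal (Z q)"
    using q fpos ffin
  proof eventually_elim
    case (elim q)
    let ?u = "f (fst p, snd q)" and ?v = "f (fst q, snd p)" and ?e = "exp (- excess c (p, q) / \<epsilon>)"
    have e: "ennreal ?e \<noteq> 0" "ennreal ?e \<noteq> \<infinity>" by (auto simp: ennreal_eq_0_iff not_le)
    have nz: "f p * f q \<noteq> 0" "f p * f q \<noteq> \<infinity>" using p elim(2,3) by (auto simp: ennreal_mult_eq_top_iff)
    then have nz': "?u * ?v * ennreal ?e \<noteq> 0" "?u * ?v * ennreal ?e \<noteq> \<infinity>"
      unfolding elim(1) by blast+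
    then have nz_uv: "?u \<noteq> 0" "?v \<noteq> 0" by auto
    with nz'(2) e have "?u \<noteq> \<infinity>" "?v \<noteq> \<infinity>" by (auto simp: ennreal_mult_eq_top_iff)
    with nz_uv have uv: "ennreal (pos ?u) = ?u" "ennreal (pos ?v) = ?v"
      by (auto intro!: pos_eq simp: zero_less_iff_neq_zero)
    have "ennreal (pos (f p)) * ennreal (pos (f q)) = ennreal (pos ?u) * ennreal (pos ?v) * ennreal ?e"
      using elim p by (simp add: uv pos_eq)
    then have "pos (f p) * pos (f q) = pos ?u * pos ?v * ?e"
      using pos by (simp add: less_imp_le flip: ennreal_mult)
    then have "pos (f q) = Z q" using pos[of "f p"] by (simp add: Z_def field_simps)
    then show ?case using pos_eq[of "f q"] elim by simp
  qed
  then have "density ?P (\<lambda>q. ennreal (Z q)) = density ?P f"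
    using ZP fP by (intro density_cong) auto
  then have "density ?P (\<lambda>q. ennreal (Z q)) = \<pi>" by (simp add: f)
  then show ?thesis
    unfolding cyclically_invariant_def
    using \<pi> ac ZP Zpos cyclic_product_if_factorized[of Z a b c \<epsilon>, OF Zab] by blast
qed

end

section \<open>Uniqueness of the cyclically invariant coupling\<close>

text \<open>
  The quotient of the two densities is \<open>a(x) b(y)\<close>. The function \<open>u(t) = (t - 1) / (t + 1)\<close> stands in
  for the logarithm: it is bounded on \<open>t > 0\<close>, satisfies \<open>u(1/t) = - u(t)\<close>, and
  \<open>u(a) + u(b) = 2 (a b - 1) / ((a + 1) (b + 1))\<close> has the sign of \<open>a b - 1\<close>. Integrating \<open>u(a) + u(b)\<close>
  against the difference of the couplings therefore gives the integral of a nonnegative function, which is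
  zero because the marginals agree.
\<close>

lemma cyclically_invariant_unique:
  fixes \<mu> :: "'a::second_countable_topology measure" and \<nu> :: "'b::second_countable_topology measure"
  assumes \<mu>: "\<mu> \<in> borel_probs" and \<nu>: "\<nu> \<in> borel_probs"
    and \<pi>: "cyclically_invariant c \<epsilon> \<mu> \<nu> \<pi>" and \<pi>': "cyclically_invariant c \<epsilon> \<mu> \<nu> \<pi>'"
  shows "\<pi> = \<pi>'"
proof -
  let ?P = "\<mu> \<Otimes>\<^sub>M \<nu>"
  note PD = borel_probsD[OF pair_borel_probs[OF \<mu> \<nu>]]
  interpret P: prob_space ?P by (rule PD)
  have ex: "\<exists>Z :: 'a \<times> 'b \<Rightarrow> real. Z \<in> borel_measurable borel \<and> (\<forall>p. 0 < Z p) \<and> density ?P (\<lambda>p. ennreal (Z p)) = \<rho> \<and>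
      (\<forall>w. Z (fst w) * Z (snd w) = exp (- excess c w / \<epsilon>) * (Z (fst (swap w)) * Z (snd (swap w))))"
    if \<rho>: "cyclically_invariant c \<epsilon> \<mu> \<nu> \<rho>" for \<rho>
  proof -
    obtain Z :: "'a \<times> 'b \<Rightarrow> real" where Z: "Z \<in> borel_measurable ?P" "\<And>p. Z p > 0"
      "density ?P (\<lambda>p. ennreal (Z p)) = \<rho>"
      and prod: "\<forall>k\<ge>1. \<forall>(x :: nat \<Rightarrow> 'a) (y :: nat \<Rightarrow> 'b). y (k + 1) = y 1 \<longrightarrow>
           (\<Prod>i=1..k. Z (x i, y i)) =
             exp (- (1 / \<epsilon>) * ((\<Sum>i=1..k. c (x i, y i)) - (\<Sum>i=1..k. c (x i, y (i + 1))))) *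
             (\<Prod>i=1..k. Z (x i, y (i + 1)))"
      using \<rho> unfolding cyclically_invariant_def by blast
    moreover have "Z \<in> borel_measurable borel"
      using Z(1) measurable_cong_sets[OF PD(2) refl] by blast
    ultimately show ?thesis using cyclically_invariant_two[OF prod] by blast
  qed
  obtain Z where Zm[measurable]: "Z \<in> borel_measurable borel" and Zpos: "\<And>p. 0 < Z p"
    and Zd: "density ?P (\<lambda>p. ennreal (Z p)) = \<pi>"
    and Z2: "\<And>w. Z (fst w) * Z (snd w) = exp (- excess c w / \<epsilon>) * (Z (fst (swap w)) * Z (snd (swap w)))"
    using ex[OF \<pi>] by blast
  obtain Z' where Zm'[measurable]: "Z' \<in> borel_measurable borel" and Zpos': "\<And>p. 0 < Z' p"
    and Zd': "density ?P (\<lambda>p. ennreal (Z' p)) = \<pi>'"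
    and Z2': "\<And>w. Z' (fst w) * Z' (snd w) = exp (- excess c w / \<epsilon>) * (Z' (fst (swap w)) * Z' (snd (swap w)))"
    using ex[OF \<pi>'] by blast
  have cp: "\<pi> \<in> couplings \<mu> \<nu>" "\<pi>' \<in> couplings \<mu> \<nu>"
    using \<pi> \<pi>' by (simp_all add: cyclically_invariant_def)
  obtain x0 :: 'a and y0 :: 'b where True by simp
  define a where "a x = Z' (x, y0) / Z (x, y0)" for x
  define b where "b y = (Z' (x0, y) / Z (x0, y)) * (Z (x0, y0) / Z' (x0, y0))" for y
  have ab_pos: "0 < a x" "0 < b y" for x y
    using Zpos Zpos' by (simp_all add: a_def b_def)
  have ratio: "Z' p = a (fst p) * b (snd p) * Z p" for p
  proof -
    obtain x y where p: "p = (x, y)" by (cases p)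
    let ?e = "exp (- excess c ((x, y), (x0, y0)) / \<epsilon>)"
    have "Z (x, y) * Z (x0, y0) = ?e * (Z (x, y0) * Z (x0, y))"
      using Z2[of "((x, y), (x0, y0))"] by (simp add: swap_def)
    moreover have "Z' (x, y) * Z' (x0, y0) = ?e * (Z' (x, y0) * Z' (x0, y))"
      using Z2'[of "((x, y), (x0, y0))"] by (simp add: swap_def)
    ultimately have "Z (x, y) = ?e * (Z (x, y0) * Z (x0, y)) / Z (x0, y0)"
      "Z' (x, y) = ?e * (Z' (x, y0) * Z' (x0, y)) / Z' (x0, y0)"
      using Zpos[of "(x0, y0)"] Zpos'[of "(x0, y0)"] by (simp_all add: field_simps)
    then show ?thesis
      using Zpos[of "(x, y0)"] Zpos[of "(x0, y)"] Zpos[of "(x0, y0)"] by (simp add: p a_def b_def)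
  qed
  have sec: "(\<lambda>x. (x, y0)) \<in> borel_measurable borel" "(\<lambda>y. (x0, y)) \<in> borel_measurable borel"
    by (intro borel_measurable_continuous_onI continuous_intros)+
  have [measurable]: "a \<in> borel_measurable borel" "b \<in> borel_measurable borel"
    unfolding a_def b_def
    using measurable_compose[OF sec(1) Zm] measurable_compose[OF sec(1) Zm']
      measurable_compose[OF sec(2) Zm] measurable_compose[OF sec(2) Zm']
    by (auto intro!: borel_measurable_divide borel_measurable_times)
  define u where "u t = (t - 1) / (t + 1)" for t :: real
  have [measurable]: "u \<in> borel_measurable borel" unfolding u_def by measurable
  have u_bd: "\<bar>u t\<bar> \<le> 1" if "0 < t" for t using that by (auto simp: u_def divide_simps abs_le_iff)
  define W where "W p = u (a (fst p)) + u (b (snd p))" for p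
  note [measurable] = measurable_fst_borel measurable_snd_borel
  have Wm[measurable]: "W \<in> borel_measurable borel" unfolding W_def by measurable
  have W_bd: "norm (W p) \<le> 2" for p
    using u_bd[OF ab_pos(1), of "fst p"] u_bd[OF ab_pos(2), of "snd p"] by (simp add: W_def)
  have W_int: "integral\<^sup>L \<rho> W = (\<integral>x. u (a x) \<partial>\<mu>) + (\<integral>y. u (b y) \<partial>\<nu>)" "integrable \<rho> W"
    if \<rho>: "\<rho> \<in> couplings \<mu> \<nu>" for \<rho>
  proof -
    note r = couplingsD[OF \<rho>]
    note rD = borel_probsD[OF r(1)]
    interpret prob_space \<rho> by (rule rD)
    have [measurable_cong]: "sets \<rho> = sets borel" by (rule rD)
    have i: "integrable \<rho> (\<lambda>p. u (a (fst p)))" "integrable \<rho> (\<lambda>p. u (b (snd p)))"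
      using u_bd[OF ab_pos(1)] u_bd[OF ab_pos(2)] by (auto intro!: integrable_const_bound[of _ 1])
    then show "integrable \<rho> W" unfolding W_def by simp
    have "(\<integral>x. u (a x) \<partial>\<mu>) = (\<integral>p. u (a (fst p)) \<partial>\<rho>)"
      unfolding r(2)[symmetric] by (intro integral_distr) measurable
    moreover have "(\<integral>y. u (b y) \<partial>\<nu>) = (\<integral>p. u (b (snd p)) \<partial>\<rho>)"
      unfolding r(3)[symmetric] by (intro integral_distr) measurable
    ultimately show "integral\<^sup>L \<rho> W = (\<integral>x. u (a x) \<partial>\<mu>) + (\<integral>y. u (b y) \<partial>\<nu>)"
      unfolding W_def using i by simp
  qed
  have [measurable_cong]: "sets ?P = sets borel" by (rule PD)
  have dens: "integral\<^sup>L \<pi> W = (\<integral>p. Z p * W p \<partial>?P)" "integral\<^sup>L \<pi>' W = (\<integral>p. Z' p * W p \<partial>?P)"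
    unfolding Zd[symmetric] Zd'[symmetric]
    by (subst integral_density; simp add: less_imp_le[OF Zpos] less_imp_le[OF Zpos'])+
  have ints: "integrable ?P (\<lambda>p. Z p * W p)" "integrable ?P (\<lambda>p. Z' p * W p)"
  proof -
    have "integrable (density ?P (\<lambda>p. ennreal (z p))) W \<longleftrightarrow> integrable ?P (\<lambda>p. z p * W p)"
      if [measurable]: "z \<in> borel_measurable borel" and z: "\<And>p. 0 < z p" for z
      by (subst integrable_density) (auto simp: less_imp_le[OF z])
    from this[OF Zm Zpos] this[OF Zm' Zpos']
    show "integrable ?P (\<lambda>p. Z p * W p)" "integrable ?P (\<lambda>p. Z' p * W p)"
      using W_int(2)[OF cp(1)] W_int(2)[OF cp(2)] unfolding Zd Zd' by blast+
  qed
  have sq: "Z' p * W p - Z p * W p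
      = 2 * (a (fst p) * b (snd p) - 1)\<^sup>2 / ((a (fst p) + 1) * (b (snd p) + 1)) * Z p" for p
  proof -
    have "a (fst p) + 1 \<noteq> 0" "b (snd p) + 1 \<noteq> 0"
      using ab_pos(1)[of "fst p"] ab_pos(2)[of "snd p"] by auto
    then have "W p = 2 * (a (fst p) * b (snd p) - 1) / ((a (fst p) + 1) * (b (snd p) + 1))"
      unfolding W_def u_def by (simp add: add_frac_eq algebra_simps)
    moreover have "Z' p * W p - Z p * W p = (a (fst p) * b (snd p) - 1) * W p * Z p"
      unfolding ratio[of p] by (simp add: algebra_simps)
    ultimately show ?thesis by (simp add: power2_eq_square)
  qed
  have "(\<integral>p. Z' p * W p - Z p * W p \<partial>?P) = 0"
    using ints dens W_int(1)[OF cp(1)] W_int(1)[OF cp(2)] by simp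
  moreover have "integrable ?P (\<lambda>p. Z' p * W p - Z p * W p)" using ints by simp
  moreover have "0 \<le> Z' p * W p - Z p * W p" for p
    unfolding sq using ab_pos(1)[of "fst p"] ab_pos(2)[of "snd p"] Zpos[of p] by simp
  ultimately have "AE p in ?P. Z' p * W p - Z p * W p = 0"
    by (subst (asm) integral_nonneg_eq_0_iff_AE) auto
  then have "AE p in ?P. Z p = Z' p"
  proof eventually_elim
    case (elim p)
    then have "a (fst p) * b (snd p) = 1"
      unfolding sq using ab_pos(1)[of "fst p"] ab_pos(2)[of "snd p"] Zpos[of p] by simp
    then show ?case using ratio[of p] by simp
  qed
  then have "density ?P (\<lambda>p. ennreal (Z p)) = density ?P (\<lambda>p. ennreal (Z' p))"
    by (intro density_cong) auto
  then show ?thesis unfolding Zd Zd' .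
qed

section \<open>Convergence of cyclically invariant couplings\<close>

lemma weak_conv_to_subseq:
  assumes "weak_conv_to M L" "strict_mono s"
  shows "weak_conv_to (\<lambda>n. M (s n)) L"
  using assms LIMSEQ_subseq_LIMSEQ[of _ _ s] unfolding weak_conv_to_def comp_def by blast

lemma uniform_limit_subseq:
  assumes "uniform_limit S f l sequentially" "strict_mono s"
  shows "uniform_limit S (\<lambda>n. f (s n)) l sequentially"
  using filterlim_compose[OF assms(1) filterlim_subseq[OF assms(2)]] .

lemma not_tendsto_subseq:
  fixes X :: "nat \<Rightarrow> 'a::metric_space"
  assumes "\<not> X \<longlonglongrightarrow> l"
  obtains e s where "e > 0" "strict_mono (s :: nat \<Rightarrow> nat)" "\<And>n. e \<le> dist (X (s n)) l"
proof -
  obtain e where e: "e > 0" "\<not> (\<forall>\<^sub>F n in sequentially. dist (X n) l < e)"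
    using assms by (auto simp: tendsto_iff)
  then have "infinite {n. e \<le> dist (X n) l}"
    by (simp add: eventually_cofinite[symmetric] cofinite_eq_sequentially not_less flip: not_less)
  from infinite_enumerate[OF this] show ?thesis using that e by auto
qed

theorem theorem1p4:
  fixes \<mu>n :: "nat \<Rightarrow> 'a::polish_space measure"
    and \<nu>n :: "nat \<Rightarrow> 'b::polish_space measure"
    and \<mu> :: "'a measure" and \<nu> :: "'b measure"
    and \<pi>n :: "nat \<Rightarrow> ('a \<times> 'b) measure"
    and cn :: "nat \<Rightarrow> 'a \<times> 'b \<Rightarrow> real" and c :: "'a \<times> 'b \<Rightarrow> real"
    and \<epsilon>n :: "nat \<Rightarrow> real" and \<epsilon> :: real
  assumes "differentiation_property (ball :: 'a \<Rightarrow> real \<Rightarrow> 'a set)"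
    and "differentiation_property (max_ball :: 'a \<times> 'b \<Rightarrow> real \<Rightarrow> ('a \<times> 'b) set)"
    and "\<And>n. n \<ge> 1 \<Longrightarrow> \<mu>n n \<in> borel_probs"
    and "\<And>n. n \<ge> 1 \<Longrightarrow> \<nu>n n \<in> borel_probs"
    and "\<And>n. n \<ge> 1 \<Longrightarrow> \<epsilon>n n > 0"
    and "\<And>n. n \<ge> 1 \<Longrightarrow> cn n \<in> borel_measurable borel"
    and "\<And>n p. n \<ge> 1 \<Longrightarrow> cn n p \<ge> 0"
    and "\<And>n. n \<ge> 1 \<Longrightarrow> \<pi>n n \<in> couplings (\<mu>n n) (\<nu>n n)"
    and "\<And>n. n \<ge> 1 \<Longrightarrow> cyclically_invariant (cn n) (\<epsilon>n n) (\<mu>n n) (\<nu>n n) (\<pi>n n)"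
    and "\<mu> \<in> borel_probs" and "weak_conv_to \<mu>n \<mu>"
    and "\<nu> \<in> borel_probs" and "weak_conv_to \<nu>n \<nu>"
    and "\<epsilon>n \<longlonglongrightarrow> \<epsilon>" and "\<epsilon> > 0"
    and "\<And>S. bounded S \<Longrightarrow> uniform_limit S cn c sequentially"
    and "continuous_on UNIV c"
  shows "\<exists>\<pi> \<in> couplings \<mu> \<nu>. weak_conv_to \<pi>n \<pi> \<and> cyclically_invariant c \<epsilon> \<mu> \<nu> \<pi>"
proof -
  note \<mu>n = assms(3) and \<nu>n = assms(4) and cn = assms(6) and \<pi>n = assms(8) and cyc = assms(9)
    and \<mu> = assms(10,11) and \<nu> = assms(12,13) and \<epsilon> = assms(14,15) and unif = assms(16) and c = assms(17)
  have c_meas: "c \<in> borel_measurable borel" by (rule borel_measurable_continuous_onI[OF c])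
  \<comment> \<open>Every subsequence has a further subsequence that converges to some cyclically invariant coupling.\<close>
  have subseq: "\<exists>r \<pi>. strict_mono r \<and> weak_conv_to (\<lambda>n. \<pi>n (s (r n))) \<pi> \<and> \<pi> \<in> couplings \<mu> \<nu> \<and>
      cyclically_invariant c \<epsilon> \<mu> \<nu> \<pi>"
    if s: "strict_mono s" and s1: "\<And>n. s n \<ge> 1" for s :: "nat \<Rightarrow> nat"
  proof -
    obtain r \<pi> R where r: "strict_mono r" and \<pi>: "\<pi> \<in> couplings \<mu> \<nu>"
      and R: "converge_on_base (\<lambda>n. \<pi>n (s (r n))) \<pi> R"
      by (rule couplings_subsequence_limit[of "\<lambda>n. \<pi>n (s n)" "\<lambda>n. \<mu>n (s n)" "\<lambda>n. \<nu>n (s n)" \<mu> \<nu>,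
            OF \<pi>n[OF s1] \<mu>n[OF s1] \<nu>n[OF s1] \<mu>(1) weak_conv_to_subseq[OF \<mu>(2) s]
              \<nu>(1) weak_conv_to_subseq[OF \<nu>(2) s]])
    have q: "strict_mono (\<lambda>n. s (r n))"
      using s r by (simp add: strict_mono_def)
    note pn = couplingsD(1)[OF \<pi>n[OF s1]] and p = couplingsD(1)[OF \<pi>]
    have wc: "weak_conv_to (\<lambda>n. \<pi>n (s (r n)) \<Otimes>\<^sub>M \<pi>n (s (r n))) (\<pi> \<Otimes>\<^sub>M \<pi>)"
      by (rule converge_on_base_imp_weak_conv_to[OF converge_on_base_pair[OF R pn p]
            pair_borel_probs[OF pn pn] pair_borel_probs[OF p p]])
    have "swap_invariant c \<epsilon> \<pi>"
    proof (rule swap_invariant_limit[OF pn p wc _ cn[OF s1] uniform_limit_subseq[OF unif q] _ \<epsilon>(2) c])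
      show "swap_invariant (cn (s (r n))) (\<epsilon>n (s (r n))) (\<pi>n (s (r n)))" for n
        by (rule cyclically_invariant_imp_swap_invariant[OF \<mu>n[OF s1] \<nu>n[OF s1] cyc[OF s1] cn[OF s1]])
      show "(\<lambda>n. \<epsilon>n (s (r n))) \<longlonglongrightarrow> \<epsilon>"
        using LIMSEQ_subseq_LIMSEQ[OF \<epsilon>(1) q] by (simp add: comp_def)
    qed
    then have "cyclically_invariant c \<epsilon> \<mu> \<nu> \<pi>"
      by (rule swap_invariant_imp_cyclically_invariant[OF \<mu>(1) \<nu>(1) \<pi> _ c_meas])
    moreover have "weak_conv_to (\<lambda>n. \<pi>n (s (r n))) \<pi>"
      by (rule converge_on_base_imp_weak_conv_to[OF R pn p])
    ultimately show ?thesis using r \<pi> by blast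
  qed
  obtain \<pi> where \<pi>: "\<pi> \<in> couplings \<mu> \<nu>" "cyclically_invariant c \<epsilon> \<mu> \<nu> \<pi>"
    using subseq[of Suc] by (auto simp: strict_mono_def)
  have "weak_conv_to \<pi>n \<pi>"
    unfolding weak_conv_to_def
  proof (intro allI impI)
    fix f :: "'a \<times> 'b \<Rightarrow> real" assume f: "continuous_on UNIV f \<and> bounded (range f)"
    show "(\<lambda>n. integral\<^sup>L (\<pi>n n) f) \<longlonglongrightarrow> integral\<^sup>L \<pi> f"
    proof (rule ccontr)
      assume "\<not> (\<lambda>n. integral\<^sup>L (\<pi>n n) f) \<longlonglongrightarrow> integral\<^sup>L \<pi> f"
      then obtain e s where e: "e > 0" and s: "strict_mono (s :: nat \<Rightarrow> nat)"
        and far: "\<And>n. e \<le> dist (integral\<^sup>L (\<pi>n (s n)) f) (integral\<^sup>L \<pi> f)"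
        by (rule not_tendsto_subseq) blast
      \<comment> \<open>The shift avoids the index 0, about which nothing is known.\<close>
      have "strict_mono (\<lambda>n. s (Suc n))" "\<And>n. s (Suc n) \<ge> 1"
        using s strict_mono_less[OF s] by (auto simp: strict_mono_def Suc_le_eq intro: le_less_trans[OF le0])
      from subseq[OF this] obtain r \<pi>' where
        wc: "weak_conv_to (\<lambda>n. \<pi>n (s (Suc (r n)))) \<pi>'" and "cyclically_invariant c \<epsilon> \<mu> \<nu> \<pi>'"
        by blast
      then have "\<pi>' = \<pi>"
        using cyclically_invariant_unique[OF \<mu>(1) \<nu>(1)] \<pi>(2) by blast
      then have "(\<lambda>n. integral\<^sup>L (\<pi>n (s (Suc (r n)))) f) \<longlonglongrightarrow> integral\<^sup>L \<pi> f"
        using wc f by (simp add: weak_conv_to_def)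
      from tendstoD[OF this e] have "\<forall>\<^sub>F n in sequentially. False"
        by eventually_elim (use far in \<open>simp add: not_less[symmetric]\<close>)
      then show False by simp
    qed
  qed
  then show ?thesis using \<pi> by blast
qed

end
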